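(* Let $E$ be a complete, separable, geodesic metric space, let $0<\epsilon<1$ and let $n\in\mathbb{N}$ (so $n\geq 1$). Suppose $\gamma$ is a closed piecewise-geodesic curve in $E$. Then there exist $N\in\mathbb{N}$ and closed piecewise-geodesic curves $\gamma_1,\dots,\gamma_N$ in $E$ such that: (1) $[[\gamma]]=\sum_{j=1}^N[[\gamma_j]]$; (2) $\displaystyle\sum_{j=1}^N\ell(\gamma_j)\le\left(1+\frac{2\epsilon}{1-\epsilon}+\frac{12\,\epsilon^{-1}}{n(1-\epsilon)}\right)\ell(\gamma)$; (3) for each $j$, $\ \|\gamma_j\|_{\mathcal{M}^1}\le 4\epsilon^{-1}+2n+10$.
   Context: Geodesic space: for every pair $x,y$ in $(E,d)$ there is a length-minimizing geodesic with endpoints $x,y$. Curves: Lipschitz curves are considered modulo increasing reparametrization and are represented by arc-length parametrizations $\gamma:[0,\ell(\gamma)]\to E$, where $\ell(\gamma)$ is the length and $\ell(\gamma|_{[0,t]})=t$ for all $t$. A curve is closed if $\gamma(\ell(\gamma))=\gamma(0)$. A geodesic is a curve with $d(\gamma(s),\gamma(t))=|s-t|$ for all $s,t\in[0,\ell(\gamma)]$. A piecewise-geodesic curve is a concatenation of finitely many geodesics (the endpoint of each being the starting point of the next). Morrey norm: $\|\gamma\|_{\mathcal{M}^1}=\sup_{r>0,\,x\in E}\frac1r\,|\{t\in[0,\ell(\gamma)]: d(x,\gamma(t))\le r\}|$, where $|\cdot|$ is Lebesgue measure. Current of a curve: for $f:E\to\mathbb{R}$ bounded Lipschitz and $\pi:E\to\mathbb{R}$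 Lipschitz, $[[\gamma]](f,\pi)=\int_0^{\ell(\gamma)}(f\circ\gamma)(t)\,d(\pi\circ\gamma)(t)$ (Riemann–Stieltjes integral). Identities between such currents mean equality on all pairs $(f,\pi)$. *)

theory Defs
  imports "HOL-Analysis.Analysis"
begin

(* Curve L g stands for g restricted to {0..L}; the values of g outside {0..L} are irrelevant. *)
datatype 'a curve = Curve (curve_len: real) (curve_at: "real \<Rightarrow> 'a")

(* Supremum over finite chains of points in [a,b]; infinite iff g is not rectifiable there. *)
definition arc_length :: "(real \<Rightarrow> 'a::metric_space) \<Rightarrow> real \<Rightarrow> real \<Rightarrow> ennreal" where
  "arc_length g a b =
     (SUP ts\<in>{ts. sorted ts \<and> set ts \<subseteq> {a..b}}.
        ennreal (\<Sum>i<length ts - 1. dist (g (ts ! i)) (g (ts ! Suc i))))"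

(* Arc-length parametrization; t = curve_len c says that curve_len c is the length of the curve. *)
definition is_curve :: "'a::metric_space curve \<Rightarrow> bool" where
  "is_curve c \<longleftrightarrow>
     0 \<le> curve_len c \<and>
     (\<forall>t\<in>{0..curve_len c}. arc_length (curve_at c) 0 t = ennreal t)"

definition closed_curve :: "'a curve \<Rightarrow> bool" where
  "closed_curve c \<longleftrightarrow> curve_at c (curve_len c) = curve_at c 0"

definition is_geodesic :: "'a::metric_space curve \<Rightarrow> bool" where
  "is_geodesic c \<longleftrightarrow>
     is_curve c \<and>
     (\<forall>s\<in>{0..curve_len c}. \<forall>t\<in>{0..curve_len c}.
        dist (curve_at c s) (curve_at c t) = \<bar>s - t\<bar>)"

definition subcurve :: "'a curve \<Rightarrow> real \<Rightarrow> real \<Rightarrow> 'a curve" where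
  "subcurve c a b = Curve (b - a) (\<lambda>t. curve_at c (a + t))"

(* A concatenation of finitely many geodesics is the concatenation of its own restrictions to
   the intervals between the successive junction times. *)
definition piecewise_geodesic :: "'a::metric_space curve \<Rightarrow> bool" where
  "piecewise_geodesic c \<longleftrightarrow>
     is_curve c \<and>
     (\<exists>(m::nat) (\<tau> :: nat \<Rightarrow> real). 1 \<le> m \<and> \<tau> 0 = 0 \<and> \<tau> m = curve_len c \<and>
        (\<forall>i<m. \<tau> i \<le> \<tau> (Suc i) \<and> is_geodesic (subcurve c (\<tau> i) (\<tau> (Suc i)))))"

definition geodesic_space :: "'a::metric_space itself \<Rightarrow> bool" where
  "geodesic_space _ \<longleftrightarrow>
     (\<forall>x y :: 'a. \<exists>c. is_geodesic c \<and> curve_at c 0 = x \<and> curve_at c (curve_len c) = y)"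

definition morrey_norm :: "'a::metric_space curve \<Rightarrow> ennreal" where
  "morrey_norm c =
     (SUP (r, x)\<in>{0<..} \<times> UNIV.
        emeasure lebesgue {t\<in>{0..curve_len c}. dist x (curve_at c t) \<le> r} / ennreal r)"

(* Riemann-Stieltjes integral of f dg: limit of the tagged sums as the mesh tends to 0. *)
definition has_rs_integral ::
    "(real \<Rightarrow> real) \<Rightarrow> (real \<Rightarrow> real) \<Rightarrow> real \<Rightarrow> real \<Rightarrow> real \<Rightarrow> bool" where
  "has_rs_integral f g a b I \<longleftrightarrow>
     (\<forall>e>0. \<exists>\<delta>>0. \<forall>p. p tagged_division_of {a..b} \<and> (\<forall>(x, K)\<in>p. Sup K - Inf K < \<delta>) \<longrightarrow>
        \<bar>(\<Sum>(x, K)\<in>p. f x * (g (Sup K) - g (Inf K))) - I\<bar> < e)"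

lemma has_rs_integral_unique:
  assumes I: "has_rs_integral f g a b I" and J: "has_rs_integral f g a b J"
  shows "I = J"
proof (rule ccontr)
  assume "I \<noteq> J"
  define e where "e = \<bar>I - J\<bar> / 2"
  have "e > 0" using \<open>I \<noteq> J\<close> by (simp add: e_def)
  obtain d1 where d1: "d1 > 0"
    "\<And>p. p tagged_division_of {a..b} \<Longrightarrow> (\<forall>(x, K)\<in>p. Sup K - Inf K < d1) \<Longrightarrow>
        \<bar>(\<Sum>(x, K)\<in>p. f x * (g (Sup K) - g (Inf K))) - I\<bar> < e"
    using I \<open>e > 0\<close> unfolding has_rs_integral_def by meson
  obtain d2 where d2: "d2 > 0"
    "\<And>p. p tagged_division_of {a..b} \<Longrightarrow> (\<forall>(x, K)\<in>p. Sup K - Inf K < d2) \<Longrightarrow>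
        \<bar>(\<Sum>(x, K)\<in>p. f x * (g (Sup K) - g (Inf K))) - J\<bar> < e"
    using J \<open>e > 0\<close> unfolding has_rs_integral_def by meson
  define d where "d = min d1 d2"
  have "gauge (\<lambda>x::real. ball x (d / 2))"
    using d1(1) d2(1) by (intro gauge_ball_dependent) (auto simp: d_def)
  then obtain p where p: "p tagged_division_of {a..b}" "(\<lambda>x. ball x (d / 2)) fine p"
    using fine_division_exists_real by blast
  have small: "Sup K - Inf K < d" if "(x, K) \<in> p" for x K
  proof -
    obtain u v where K: "K = {u..v}"
      using p(1) \<open>(x, K) \<in> p\<close> by (metis tagged_division_ofD(4) box_real(2))
    moreover have "x \<in> K" using p(1) \<open>(x, K) \<in> p\<close> by (rule tagged_division_ofD(2))
    moreover have "K \<subseteq> ball x (d / 2)" using p(2) \<open>(x, K) \<in> p\<close> unfolding fine_def by blast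
    ultimately have "u \<le> v" and "u \<in> K" "v \<in> K" and "K \<subseteq> ball x (d / 2)" by auto
    then have "u \<in> ball x (d / 2)" "v \<in> ball x (d / 2)" by blast+
    then show ?thesis using \<open>u \<le> v\<close> by (simp add: K dist_real_def abs_if split: if_splits)
  qed
  have "\<forall>(x, K)\<in>p. Sup K - Inf K < d1" "\<forall>(x, K)\<in>p. Sup K - Inf K < d2"
    using small by (force simp: d_def)+
  then show False using d1(2)[OF p(1)] d2(2)[OF p(1)] unfolding e_def by argo
qed

definition rs_integral :: "(real \<Rightarrow> real) \<Rightarrow> (real \<Rightarrow> real) \<Rightarrow> real \<Rightarrow> real \<Rightarrow> real" where
  "rs_integral f g a b = (THE I. has_rs_integral f g a b I)"

definition current :: "'a::metric_space curve \<Rightarrow> ('a \<Rightarrow> real) \<Rightarrow> ('a \<Rightarrow> real) \<Rightarrow> real" where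
  "current c f \<pi> = rs_integral (f \<circ> curve_at c) (\<pi> \<circ> curve_at c) 0 (curve_len c)"

definition is_lipschitz :: "('a::metric_space \<Rightarrow> real) \<Rightarrow> bool" where
  "is_lipschitz f \<longleftrightarrow> (\<exists>C. C-lipschitz_on UNIV f)"

end

theory Submission
  imports Defs
begin

text \<open>
  The loops are cut out of the curve one at a time. Fix a scale \<open>\<delta> > 0\<close>. Cutting the closed curve at
  two times \<open>s \<le> t\<close> and inserting a geodesic chord between the two points, once in each direction,
  produces two closed curves: the loop, made of the arc from \<open>s\<close> to \<open>t\<close> and the chord, and the rest.
  The two copies of the chord cancel in the currents (\<open>cut_along_chord\<close>). Two kinds of cuts are made.

  \<^item> If \<open>k = n + 4\<close> consecutive geodesic pieces fit into length \<open>\<delta>\<close>, these are cut off. The loop has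
    \<open>k + 1\<close> pieces, each of which spends time at most \<open>2 r\<close> in a ball of radius \<open>r\<close>, and this bounds its
    Morrey norm. The rest is no longer than before and has \<open>k - 1\<close> pieces fewer; the loop
    costs length at most \<open>2 \<delta>\<close>.

  \<^item> Otherwise, if the length is at least \<open>\<delta>\<close>, consider the arcs of length \<open>a \<ge> \<delta>\<close> whose endpoints are at
    distance at most \<open>\<epsilon> a\<close>. The whole curve is one, as it is closed, and a shortest one exists by
    compactness (\<open>shortest_shortcut\<close>). Cutting it off shortens the curve by at least \<open>(1 - \<epsilon>) a\<close> at the
    cost of a loop of length at most \<open>(1 + \<epsilon>) a\<close>, whence the factor \<open>(1 + \<epsilon>) / (1 - \<epsilon>)\<close>. The Morrey norm of
    the loop is controlled on large scales by minimality, since its arc is quasi-geodesic there, and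
    on scales below \<open>\<delta>\<close> because a window of length \<open>\<delta>\<close> meets at most \<open>k + 1\<close> pieces
    (\<open>polygonal_window\<close>, \<open>emeasure_visits_quasi_geodesic\<close>).

  A curve on which neither cut applies is shorter than \<open>\<delta>\<close> and so has at most \<open>k + 1\<close> pieces.
  A shortcut adds at most two pieces to the rest, but there is room for only about
  \<open>L / ((1 - \<epsilon>) \<delta>)\<close> shortcuts, \<open>L\<close> being the length. So \<open>m + 3 L / ((1 - \<epsilon>) \<delta>)\<close>, with \<open>m\<close> the number of pieces,
  decreases by at least 1 in every step, and by at least \<open>k - 1\<close> in a cut of the first kind. It therefore
  proves termination and bounds the total cost of the cuts of the first kind
  (\<open>loop_decomposition\<close>). With \<open>\<delta> = L / m\<close> that cost is of order \<open>L / ((1 - \<epsilon>) n)\<close>, whatever \<open>m\<close> was.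

  The currents behave as expected under these operations because a Riemann-Stieltjes integral \<open>\<integral> f dg\<close> of
  Lipschitz functions is the increment of a function \<open>\<Phi>\<close> with
  \<open>\<Phi> v - \<Phi> u = f x (g v - g u) + O((v - u)\<^sup>2)\<close>, a local condition that is inherited by subintervals, shifts
  and reflections.
\<close>

section \<open>Riemann-Stieltjes integrals of Lipschitz functions\<close>

text \<open>
  The indefinite integral \<open>\<integral> f dg\<close>, recognised by a local first-order estimate. The error is of
  second order when \<open>f\<close> and \<open>g\<close> are Lipschitz, which makes the errors over a fine division
  add up to something small.
\<close>
definition stieltjes_primitive ::
    "(real \<Rightarrow> real) \<Rightarrow> (real \<Rightarrow> real) \<Rightarrow> (real \<Rightarrow> real) \<Rightarrow> real \<Rightarrow> real \<Rightarrow> bool" where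
  "stieltjes_primitive \<Phi> f g a b \<longleftrightarrow>
     (\<exists>C. \<forall>u x v. a \<le> u \<and> u \<le> x \<and> x \<le> v \<and> v \<le> b \<longrightarrow>
        \<bar>\<Phi> v - \<Phi> u - f x * (g v - g u)\<bar> \<le> C * (v - u)\<^sup>2)"

text \<open>
  Over a division of mesh below \<open>\<delta>\<close> the increments of \<open>\<Phi>\<close> telescope, and the errors add up to at most
  \<open>C \<delta> (b - a)\<close>.
\<close>
lemma has_rs_integral_of_primitive:
  assumes "a \<le> b" and "stieltjes_primitive \<Phi> f g a b"
  shows "has_rs_integral f g a b (\<Phi> b - \<Phi> a)"
  unfolding has_rs_integral_def
proof (intro allI impI)
  fix e :: real
  assume "e > 0"
  obtain C0 where C0: "\<bar>\<Phi> v - \<Phi> u - f x * (g v - g u)\<bar> \<le> C0 * (v - u)\<^sup>2"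
    if "a \<le> u" "u \<le> x" "x \<le> v" "v \<le> b" for u x v
    using assms(2) unfolding stieltjes_primitive_def by blast
  \<comment> \<open>A positive constant is needed to divide by it.\<close>
  define C where "C = max C0 1"
  have C: "\<bar>\<Phi> v - \<Phi> u - f x * (g v - g u)\<bar> \<le> C * (v - u)\<^sup>2"
    if "a \<le> u" "u \<le> x" "x \<le> v" "v \<le> b" for u x v
    using C0[OF that] mult_right_mono[of C0 C "(v - u)\<^sup>2"] by (simp add: C_def)
  define \<delta> where "\<delta> = e / (C * (b - a + 1))"
  have "C > 0" and pos: "C * (b - a + 1) > 0"
    using \<open>a \<le> b\<close> by (auto simp: C_def)
  show "\<exists>\<delta>>0. \<forall>p. p tagged_division_of {a..b} \<and> (\<forall>(x, K)\<in>p. Sup K - Inf K < \<delta>) \<longrightarrow>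
          \<bar>(\<Sum>(x, K)\<in>p. f x * (g (Sup K) - g (Inf K))) - (\<Phi> b - \<Phi> a)\<bar> < e"
  proof (intro exI[of _ \<delta>] conjI allI impI)
    show "\<delta> > 0" using \<open>e > 0\<close> pos by (simp add: \<delta>_def)
    fix p
    assume "p tagged_division_of {a..b} \<and> (\<forall>(x, K)\<in>p. Sup K - Inf K < \<delta>)"
    then have p: "p tagged_division_of {a..b}" "\<forall>(x, K)\<in>p. Sup K - Inf K < \<delta>" by auto
    have tele: "(\<Sum>(x, K)\<in>p. h (Sup K) - h (Inf K)) = h b - h a" for h :: "real \<Rightarrow> real"
      using additive_tagged_division_1[OF \<open>a \<le> b\<close> p(1)] by blast
    have term_le: "\<bar>f x * (g (Sup K) - g (Inf K)) - (\<Phi> (Sup K) - \<Phi> (Inf K))\<bar>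
                  \<le> C * \<delta> * (Sup K - Inf K)" if xK: "(x, K) \<in> p" for x K
    proof -
      obtain u v where K: "K = {u..v}"
        using tagged_division_ofD(4)[OF p(1) xK] unfolding box_real by blast
      have "x \<in> K" "K \<subseteq> {a..b}" by (fact tagged_division_ofD(2,3)[OF p(1) xK])+
      then have *: "a \<le> u" "u \<le> x" "x \<le> v" "v \<le> b" unfolding K by auto
      have "Sup K - Inf K < \<delta>" using p(2) that by blast
      moreover have SI: "Sup K = v" "Inf K = u" using K * by auto
      ultimately have "v - u < \<delta>" by simp
      have "\<bar>f x * (g v - g u) - (\<Phi> v - \<Phi> u)\<bar> \<le> C * (v - u)\<^sup>2"
        using C[OF *] by linarith
      also have "\<dots> \<le> C * (\<delta> * (v - u))"
        using mult_right_mono[of "v - u" \<delta> "v - u"] \<open>v - u < \<delta>\<close> * \<open>C > 0\<close>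
        by (intro mult_left_mono) (auto simp: power2_eq_square)
      finally show ?thesis unfolding SI by (simp only: mult.assoc)
    qed
    have "(\<Sum>(x, K)\<in>p. f x * (g (Sup K) - g (Inf K))) - (\<Phi> b - \<Phi> a)
        = (\<Sum>(x, K)\<in>p. f x * (g (Sup K) - g (Inf K)) - (\<Phi> (Sup K) - \<Phi> (Inf K)))"
      unfolding tele[of \<Phi>, symmetric] by (simp add: sum_subtractf case_prod_unfold)
    also have "\<bar>\<dots>\<bar> \<le> (\<Sum>(x, K)\<in>p. C * \<delta> * (Sup K - Inf K))"
      by (intro order_trans[OF sum_abs] sum_mono) (use term_le in auto)
    also have "\<dots> = C * \<delta> * (b - a)"
      using tele[of "\<lambda>x. x"] by (simp add: case_prod_unfold flip: sum_distrib_left)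
    also have "\<dots> < e"
    proof -
      have "C * \<delta> * (b - a + 1) = e" using pos \<open>C > 0\<close> by (simp add: \<delta>_def field_simps)
      moreover have "C * \<delta> > 0" using \<open>C > 0\<close> \<open>\<delta> > 0\<close> by simp
      ultimately show ?thesis by (simp add: algebra_simps)
    qed
    finally show "\<bar>(\<Sum>(x, K)\<in>p. f x * (g (Sup K) - g (Inf K))) - (\<Phi> b - \<Phi> a)\<bar> < e" .
  qed
qed

lemma rs_integral_of_primitive:
  assumes "a \<le> b" and "stieltjes_primitive \<Phi> f g a b"
  shows "rs_integral f g a b = \<Phi> b - \<Phi> a"
  unfolding rs_integral_def
  using has_rs_integral_of_primitive[OF assms] has_rs_integral_unique by blast

lemma stieltjes_primitive_cong:
  assumes "stieltjes_primitive \<Phi> f g a b"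
    and "\<And>t. a \<le> t \<Longrightarrow> t \<le> b \<Longrightarrow> f' t = f t" "\<And>t. a \<le> t \<Longrightarrow> t \<le> b \<Longrightarrow> g' t = g t"
  shows "stieltjes_primitive \<Phi> f' g' a b"
proof -
  have "f' x = f x \<and> g' u = g u \<and> g' v = g v" if "a \<le> u \<and> u \<le> x \<and> x \<le> v \<and> v \<le> b" for u x v
    using that assms(2,3) by auto
  then show ?thesis using assms(1) unfolding stieltjes_primitive_def by metis
qed

lemma stieltjes_primitive_subinterval:
  "stieltjes_primitive \<Phi> f g a b \<Longrightarrow> a \<le> c \<Longrightarrow> d \<le> b \<Longrightarrow> stieltjes_primitive \<Phi> f g c d"
  unfolding stieltjes_primitive_def by (meson order_trans)

lemma stieltjes_primitive_shift:
  assumes "stieltjes_primitive \<Phi> f g (a + s) (b + s)"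
  shows "stieltjes_primitive (\<lambda>t. \<Phi> (t + s)) (\<lambda>t. f (t + s)) (\<lambda>t. g (t + s)) a b"
proof -
  obtain C where C: "\<bar>\<Phi> v - \<Phi> u - f x * (g v - g u)\<bar> \<le> C * (v - u)\<^sup>2"
    if "a + s \<le> u" "u \<le> x" "x \<le> v" "v \<le> b + s" for u x v
    using assms unfolding stieltjes_primitive_def by blast
  show ?thesis unfolding stieltjes_primitive_def
    using C[of "u + s" "x + s" "v + s" for u x v] by (intro exI[of _ C]) auto
qed

text \<open>
  Reflection reverses increments of \<open>g\<close> and of \<open>\<Phi>\<close> alike, so no sign appears; the sign of the reversed
  integral comes from evaluating at exchanged endpoints.
\<close>
lemma stieltjes_primitive_reflect:
  assumes "stieltjes_primitive \<Phi> f g 0 l"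
  shows "stieltjes_primitive (\<lambda>t. \<Phi> (l - t)) (\<lambda>t. f (l - t)) (\<lambda>t. g (l - t)) 0 l"
proof -
  obtain C where C: "\<bar>\<Phi> v - \<Phi> u - f x * (g v - g u)\<bar> \<le> C * (v - u)\<^sup>2"
    if "0 \<le> u" "u \<le> x" "x \<le> v" "v \<le> l" for u x v
    using assms unfolding stieltjes_primitive_def by blast
  have "\<bar>\<Phi> (l - v) - \<Phi> (l - u) - f (l - x) * (g (l - v) - g (l - u))\<bar> \<le> C * (v - u)\<^sup>2"
    if "0 \<le> u" "u \<le> x" "x \<le> v" "v \<le> l" for u x v
  proof -
    have "\<bar>\<Phi> (l - u) - \<Phi> (l - v) - f (l - x) * (g (l - u) - g (l - v))\<bar> \<le> C * (v - u)\<^sup>2"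
      using C[of "l - v" "l - x" "l - u"] that by simp
    moreover have "\<Phi> (l - v) - \<Phi> (l - u) - f (l - x) * (g (l - v) - g (l - u))
       = - (\<Phi> (l - u) - \<Phi> (l - v) - f (l - x) * (g (l - u) - g (l - v)))"
      by (simp add: algebra_simps)
    ultimately show ?thesis by (simp only: abs_minus_cancel)
  qed
  then show ?thesis unfolding stieltjes_primitive_def by blast
qed

text \<open>
  For increasing bi-Lipschitz \<open>h\<close>, substituting \<open>y = h t\<close> turns \<open>\<integral> f dh\<close> into the ordinary integral
  of the continuous function \<open>f \<circ> h\<inverse>\<close>.
\<close>
lemma stieltjes_primitive_bilipschitz:
  assumes ab: "a \<le> b" and f: "F-lipschitz_on {a..b} f"
    and h: "\<And>u v. a \<le> u \<Longrightarrow> u \<le> v \<Longrightarrow> v \<le> b \<Longrightarrow> v - u \<le> h v - h u \<and> h v - h u \<le> H * (v - u)"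
  shows "\<exists>\<Phi>. stieltjes_primitive \<Phi> f h a b"
proof -
  define k where "k = the_inv_into {a..b} h"
  have strict: "h u < h v" if "a \<le> u" "u < v" "v \<le> b" for u v
    using h[of u v] that by linarith
  have mono: "h u \<le> h v" if "a \<le> u" "u \<le> v" "v \<le> b" for u v
    using h[of u v] that by linarith
  have inj: "inj_on h {a..b}"
    by (intro linorder_inj_onI') (use strict in force)
  have k: "k (h t) = t" if "a \<le> t" "t \<le> b" for t
    using inj that by (simp add: k_def the_inv_into_f_f)
  have dist_h: "\<bar>h v - h u\<bar> \<le> H * \<bar>v - u\<bar>" "\<bar>v - u\<bar> \<le> \<bar>h v - h u\<bar>" if "u \<in> {a..b}" "v \<in> {a..b}" for u v
    using h[of u v] h[of v u] that by (cases "u \<le> v"; force)+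
  have conth: "continuous_on {a..b} h"
  proof -
    have "(max H 0)-lipschitz_on {a..b} h"
    proof (rule lipschitz_onI)
      fix x y assume "x \<in> {a..b}" "y \<in> {a..b}"
      then show "dist (h x) (h y) \<le> max H 0 * dist x y"
        using dist_h(1)[of y x] mult_right_mono[of H "max H 0" "\<bar>x - y\<bar>"] by (simp add: dist_real_def)
    qed simp
    then show ?thesis by (rule lipschitz_on_continuous_on)
  qed
  have onto: "\<exists>t. a \<le> t \<and> t \<le> b \<and> h t = y" if "h a \<le> y" "y \<le> h b" for y
    using IVT'[of h a y b] that ab conth by blast
  have kin: "a \<le> k y" "k y \<le> b" "h (k y) = y" if "h a \<le> y" "y \<le> h b" for y
    using onto[OF that] k by auto
  have fk: "\<bar>f s - f t\<bar> \<le> F * \<bar>s - t\<bar>" if "s \<in> {a..b}" "t \<in> {a..b}" for s t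
    using lipschitz_onD[OF f that] by (simp add: dist_real_def)
  have F0: "F \<ge> 0" using f lipschitz_on_nonneg by blast
  have cont: "continuous_on {h a..h b} (\<lambda>y. f (k y))"
  proof -
    have "F-lipschitz_on {h a..h b} (\<lambda>y. f (k y))"
    proof (rule lipschitz_onI)
      fix x y assume xy: "x \<in> {h a..h b}" "y \<in> {h a..h b}"
      have "\<bar>f (k x) - f (k y)\<bar> \<le> F * \<bar>k x - k y\<bar>"
        using fk kin xy by auto
      also have "\<dots> \<le> F * \<bar>x - y\<bar>"
        using dist_h(2)[of "k y" "k x"] kin xy F0 by (intro mult_left_mono) auto
      finally show "dist (f (k x)) (f (k y)) \<le> F * dist x y" by (simp add: dist_real_def)
    qed (rule F0)
    then show ?thesis by (rule lipschitz_on_continuous_on)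
  qed
  define \<Phi> where "\<Phi> t = integral {h a..h t} (\<lambda>y. f (k y))" for t
  have "\<bar>\<Phi> v - \<Phi> u - f x * (h v - h u)\<bar> \<le> (F * H) * (v - u)\<^sup>2"
    if uxv: "a \<le> u" "u \<le> x" "x \<le> v" "v \<le> b" for u x v
  proof -
    have le: "h a \<le> h u" "h u \<le> h v" "h v \<le> h b" using mono that by auto
    have int: "(\<lambda>y. f (k y)) integrable_on {p..q}" if "h a \<le> p" "q \<le> h b" for p q
      using that by (intro integrable_continuous_real continuous_on_subset[OF cont]) auto
    have "\<Phi> u + integral {h u..h v} (\<lambda>y. f (k y)) = \<Phi> v"
      unfolding \<Phi>_def using le by (intro Henstock_Kurzweil_Integration.integral_combine int) auto
    moreover have "integral {h u..h v} (\<lambda>y. f (k y) - f x)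
        = integral {h u..h v} (\<lambda>y. f (k y)) - f x * (h v - h u)"
      using le int[of "h u" "h v"] by (subst Henstock_Kurzweil_Integration.integral_diff) (auto simp: mult.commute)
    moreover have "norm (integral {h u..h v} (\<lambda>y. f (k y) - f x)) \<le> (F * (v - u)) * (h v - h u)"
    proof (rule integral_bound)
      show "h u \<le> h v" by fact
      show "continuous_on {h u..h v} (\<lambda>y. f (k y) - f x)"
        using le by (intro continuous_intros continuous_on_subset[OF cont]) auto
      show "norm (f (k y) - f x) \<le> F * (v - u)" if y: "y \<in> {h u..h v}" for y
      proof -
        have *: "a \<le> k y" "k y \<le> b" "h (k y) = y" using kin[of y] y le by auto
        have "u \<le> k y" using strict[of "k y" u] * y uxv by force
        moreover have "k y \<le> v" using strict[of v "k y"] * y uxv by force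
        ultimately have "\<bar>k y - x\<bar> \<le> v - u" using uxv by linarith
        then show ?thesis
          using fk[of "k y" x] * uxv mult_left_mono[OF \<open>\<bar>k y - x\<bar> \<le> v - u\<close> F0] by auto
      qed
    qed
    moreover have "(F * (v - u)) * (h v - h u) \<le> (F * (v - u)) * (H * (v - u))"
      using h[of u v] uxv F0 by (intro mult_left_mono) auto
    ultimately show ?thesis by (simp add: power2_eq_square algebra_simps)
  qed
  then show ?thesis unfolding stieltjes_primitive_def by blast
qed

text \<open>
  Adding a steep linear function to \<open>g\<close> makes it increasing and bi-Lipschitz; the linear function itself
  is handled by the same lemma, and the estimate is linear in \<open>g\<close>.
\<close>
lemma stieltjes_primitive_exists:
  assumes "a \<le> b" and f: "F-lipschitz_on {a..b} f" and g: "G-lipschitz_on {a..b} g"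
  obtains \<Phi> where "stieltjes_primitive \<Phi> f g a b"
proof -
  define h where "h t = g t + (G + 1) * t" for t
  have "v - u \<le> h v - h u \<and> h v - h u \<le> (2 * G + 1) * (v - u)"
    if "a \<le> u" "u \<le> v" "v \<le> b" for u v
  proof -
    have "\<bar>g v - g u\<bar> \<le> G * (v - u)"
      using lipschitz_onD[OF g, of v u] that by (simp add: dist_real_def)
    then show ?thesis by (simp add: h_def algebra_simps) linarith
  qed
  from stieltjes_primitive_bilipschitz[OF \<open>a \<le> b\<close> f this]
  obtain \<Phi>1 C1 where 1: "\<bar>\<Phi>1 v - \<Phi>1 u - f x * (h v - h u)\<bar> \<le> C1 * (v - u)\<^sup>2"
    if "a \<le> u" "u \<le> x" "x \<le> v" "v \<le> b" for u x v
    unfolding stieltjes_primitive_def by blast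
  have "\<exists>\<Phi>. stieltjes_primitive \<Phi> f (\<lambda>t. t) a b"
    by (rule stieltjes_primitive_bilipschitz[OF \<open>a \<le> b\<close> f, where H = 1]) simp
  then obtain \<Phi>2 C2 where 2: "\<bar>\<Phi>2 v - \<Phi>2 u - f x * (v - u)\<bar> \<le> C2 * (v - u)\<^sup>2"
    if "a \<le> u" "u \<le> x" "x \<le> v" "v \<le> b" for u x v
    unfolding stieltjes_primitive_def by blast
  have G0: "G \<ge> 0" using g lipschitz_on_nonneg by blast
  have "stieltjes_primitive (\<lambda>t. \<Phi>1 t - (G + 1) * \<Phi>2 t) f g a b"
    unfolding stieltjes_primitive_def
  proof (intro exI[of _ "C1 + (G + 1) * C2"] allI impI)
    fix u x v assume "a \<le> u \<and> u \<le> x \<and> x \<le> v \<and> v \<le> b"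
    then have *: "a \<le> u" "u \<le> x" "x \<le> v" "v \<le> b" by auto
    let ?A = "\<Phi>1 v - \<Phi>1 u - f x * (h v - h u)" and ?B = "\<Phi>2 v - \<Phi>2 u - f x * (v - u)"
    have "\<Phi>1 v - (G + 1) * \<Phi>2 v - (\<Phi>1 u - (G + 1) * \<Phi>2 u) - f x * (g v - g u) = ?A - (G + 1) * ?B"
      by (simp add: h_def algebra_simps)
    also have "\<bar>\<dots>\<bar> \<le> \<bar>?A\<bar> + \<bar>(G + 1) * ?B\<bar>" by (rule abs_triangle_ineq4)
    also have "\<dots> \<le> C1 * (v - u)\<^sup>2 + (G + 1) * (C2 * (v - u)\<^sup>2)"
      using 1[OF *] mult_left_mono[OF 2[OF *], of "G + 1"] G0
      unfolding abs_mult by (intro add_mono) auto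
    finally show "\<bar>\<Phi>1 v - (G + 1) * \<Phi>2 v - (\<Phi>1 u - (G + 1) * \<Phi>2 u) - f x * (g v - g u)\<bar>
       \<le> (C1 + (G + 1) * C2) * (v - u)\<^sup>2" by (simp add: algebra_simps)
  qed
  then show thesis by (rule that)
qed

section \<open>Concatenations of geodesics\<close>

definition geodesic_on :: "(real \<Rightarrow> 'a::metric_space) \<Rightarrow> real \<Rightarrow> real \<Rightarrow> bool" where
  "geodesic_on g a b \<longleftrightarrow> (\<forall>s\<in>{a..b}. \<forall>t\<in>{a..b}. dist (g s) (g t) = \<bar>s - t\<bar>)"

text \<open>
  The number of pieces is recorded because it bounds the time spent in small balls. Pieces of
  length 0 are allowed, so that a concatenation of \<open>m\<close> pieces is also one of any larger number, and
  all counts below may be read as upper bounds.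
\<close>
primrec polygonal :: "nat \<Rightarrow> (real \<Rightarrow> 'a::metric_space) \<Rightarrow> real \<Rightarrow> real \<Rightarrow> bool" where
  "polygonal 0 g a b \<longleftrightarrow> a = b"
| "polygonal (Suc m) g a b \<longleftrightarrow> (\<exists>c. a \<le> c \<and> c \<le> b \<and> geodesic_on g a c \<and> polygonal m g c b)"

lemma geodesic_on_subset: "geodesic_on g a b \<Longrightarrow> a \<le> c \<Longrightarrow> d \<le> b \<Longrightarrow> geodesic_on g c d"
  by (auto simp: geodesic_on_def)

lemma polygonal_le: "polygonal m g a b \<Longrightarrow> a \<le> b"
  by (cases m) auto

lemma polygonal_geodesic: "geodesic_on g a b \<Longrightarrow> a \<le> b \<Longrightarrow> polygonal 1 g a b"
  by auto

lemma polygonal_append: "polygonal m g a b \<Longrightarrow> polygonal k g b c \<Longrightarrow> polygonal (m + k) g a c"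
proof (induction m arbitrary: a)
  case (Suc m)
  then obtain d where "a \<le> d" "d \<le> b" "geodesic_on g a d" "polygonal (m + k) g d c" by auto
  moreover have "b \<le> c" using Suc.prems polygonal_le by blast
  ultimately show ?case by fastforce
qed auto

lemma polygonal_split:
  "polygonal (i + j) g a b \<Longrightarrow> \<exists>c. polygonal i g a c \<and> polygonal j g c b"
proof (induction i arbitrary: a)
  case (Suc i)
  then obtain d where d: "a \<le> d" "geodesic_on g a d" "polygonal (i + j) g d b" by auto
  with Suc.IH obtain c where c: "polygonal i g d c" "polygonal j g c b" by blast
  moreover have "polygonal (Suc i) g a c" using c d polygonal_le by fastforce
  ultimately show ?case by blast
qed auto

lemma polygonal_mono:
  assumes "polygonal m g a b" "m \<le> k"
  shows "polygonal k g a b"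
proof -
  have "polygonal j g b b" for j by (induction j) (auto simp: geodesic_on_def)
  from polygonal_append[OF assms(1) this, of "k - m"] show ?thesis using assms(2) by simp
qed

text \<open>
  Only the piece that contains \<open>c\<close> is split, so a cut raises the total count by at most one.
\<close>
lemma polygonal_cut:
  assumes "polygonal m g a b" "a \<le> c" "c \<le> b"
  shows "\<exists>i j. i + j \<le> Suc m \<and> i \<le> m \<and> j \<le> m \<and> polygonal i g a c \<and> polygonal j g c b"
  using assms
proof (induction m arbitrary: a)
  case 0
  then show ?case by auto
next
  case (Suc m)
  then obtain d where d: "a \<le> d" "d \<le> b" "geodesic_on g a d" "polygonal m g d b" by auto
  show ?case
  proof (cases "c \<le> d")
    case True
    have "polygonal 1 g a c" "polygonal (Suc m) g c b"
      using d True Suc.prems geodesic_on_subset[of g a d] by auto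
    then show ?thesis by (intro exI[of _ 1] exI[of _ "Suc m"]) simp
  next
    case False
    with Suc.IH[OF d(4)] Suc.prems obtain i j where ij: "i + j \<le> Suc m" "i \<le> m" "j \<le> m"
      "polygonal i g d c" "polygonal j g c b" by auto
    moreover have "polygonal (Suc i) g a c" using ij d False by fastforce
    ultimately show ?thesis by (intro exI[of _ "Suc i"] exI[of _ j]) simp
  qed
qed

lemma polygonal_sub:
  assumes "polygonal m g a b" "a \<le> c" "c \<le> d" "d \<le> b"
  shows "polygonal m g c d"
proof -
  obtain i where "i \<le> m" "polygonal i g c b" using polygonal_cut[of m g a b c] assms by auto
  moreover obtain j where "j \<le> i" "polygonal j g c d"
    using polygonal_cut[of i g c b d] assms calculation by auto
  ultimately show ?thesis using polygonal_mono by (meson le_trans)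
qed

lemma polygonal_shift:
  "polygonal m g (a + s) (b + s) \<Longrightarrow> (\<And>t. a \<le> t \<Longrightarrow> t \<le> b \<Longrightarrow> h t = g (t + s)) \<Longrightarrow> polygonal m h a b"
proof (induction m arbitrary: a)
  case (Suc m)
  then obtain c where c: "a + s \<le> c" "c \<le> b + s" "geodesic_on g (a + s) c" "polygonal m g c (b + s)"
    by auto
  have "polygonal m h (c - s) b" using Suc.IH[of "c - s"] c Suc.prems(2) by auto
  moreover have "geodesic_on h a (c - s)"
    using c Suc.prems(2) unfolding geodesic_on_def by (auto simp: algebra_simps)
  ultimately show ?case using c by (auto intro!: exI[of _ "c - s"])
qed auto

lemma polygonal_lipschitz:
  assumes "polygonal m g a b" "s \<in> {a..b}" "t \<in> {a..b}"
  shows "dist (g s) (g t) \<le> \<bar>s - t\<bar>"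
proof -
  have *: "dist (g u) (g v) \<le> v - u" if "polygonal m g u v" for m u v
    using that
  proof (induction m arbitrary: u)
    case (Suc m)
    then obtain c where c: "u \<le> c" "geodesic_on g u c" "polygonal m g c v" by auto
    have "dist (g u) (g v) \<le> dist (g u) (g c) + dist (g c) (g v)" by (rule dist_triangle)
    also have "\<dots> \<le> (c - u) + (v - c)"
      using c Suc.IH by (intro add_mono) (auto simp: geodesic_on_def)
    finally show ?case by simp
  qed auto
  show ?thesis
    using *[OF polygonal_sub[OF assms(1), of s t]] *[OF polygonal_sub[OF assms(1), of t s]] assms(2,3)
    by (cases "s \<le> t") (auto simp: dist_commute)
qed

lemma polygonal_continuous: "polygonal m g a b \<Longrightarrow> continuous_on {a..b} g"
  by (rule lipschitz_on_continuous_on[of 1], rule lipschitz_onI)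
     (use polygonal_lipschitz[of m g a b] in \<open>auto simp: dist_real_def\<close>)

text \<open>
  Either some \<open>k\<close> consecutive pieces fit into length \<open>\<delta>\<close>, or a window of length \<open>\<delta>\<close> never contains \<open>k\<close> full
  pieces after the first junction in it. In the second case it meets, after the piece in which it
  starts, at most \<open>k\<close> further ones.
\<close>
lemma polygonal_window:
  assumes "polygonal m g a b"
  shows "(\<exists>i u v. i + k \<le> m \<and> polygonal i g a u \<and> polygonal k g u v \<and> polygonal (m - i - k) g v b \<and> v - u \<le> \<delta>)
       \<or> (\<forall>p q. a \<le> p \<and> p \<le> q \<and> q \<le> b \<and> q - p \<le> \<delta> \<longrightarrow> polygonal (Suc k) g p q)"
  using assms
proof (induction m arbitrary: a)
  case 0
  have "polygonal k g a a" for k by (induction k) (auto simp: geodesic_on_def)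
  then show ?case using 0 by (metis order_antisym order_trans polygonal.simps(1))
next
  case (Suc m)
  then obtain c where c: "a \<le> c" "c \<le> b" "geodesic_on g a c" "polygonal m g c b" by auto
  show ?case
  proof (cases "\<exists>i u v. i + k \<le> m \<and> polygonal i g c u \<and> polygonal k g u v \<and> polygonal (m - i - k) g v b \<and> v - u \<le> \<delta>")
    case True
    then obtain i u v where *: "i + k \<le> m" "polygonal i g c u" "polygonal k g u v"
      "polygonal (m - i - k) g v b" "v - u \<le> \<delta>" by blast
    moreover have "polygonal (Suc i) g a u" using * c polygonal_le by fastforce
    ultimately show ?thesis
      by (intro disjI1 exI[of _ "Suc i"] exI[of _ u] exI[of _ v]) simp
  next
    case False
    with Suc.IH[OF c(4)] have win: "polygonal (Suc k) g p q"
      if "c \<le> p" "p \<le> q" "q \<le> b" "q - p \<le> \<delta>" for p q using that by blast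
    \<comment> \<open>A window that starts at the junction \<open>c\<close> lies within the first \<open>k\<close> pieces after \<open>c\<close>.\<close>
    have start: "polygonal k g c q" if "c \<le> q" "q \<le> b" "q - c \<le> \<delta>" for q
    proof (cases "k \<le> m")
      case True
      then obtain v where v: "polygonal k g c v" "polygonal (m - k) g v b"
        using polygonal_split[of k "m - k" g c b] c by auto
      have "\<not> v - c \<le> \<delta>" using False v True by (auto dest: spec[of _ 0])
      then show ?thesis using that polygonal_sub[OF v(1), of c q] by simp
    next
      case k: False
      then show ?thesis using that polygonal_mono[OF polygonal_sub[OF c(4), of c q], of k] by simp
    qed
    have "polygonal (Suc k) g p q" if "a \<le> p" "p \<le> q" "q \<le> b" "q - p \<le> \<delta>" for p q
    proof -
      consider "c \<le> p" | "q \<le> c" | "p \<le> c" "c \<le> q" by linarith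
      then show ?thesis
      proof cases
        case 2
        then have "polygonal 1 g p q" using that c geodesic_on_subset[of g a c p q] by auto
        then show ?thesis by (rule polygonal_mono) simp
      next
        case 3
        then have "geodesic_on g p c" using that c geodesic_on_subset[of g a c p c] by auto
        then show ?thesis using start[of q] 3 that by auto
      qed (use win that in blast)
    qed
    then show ?thesis by blast
  qed
qed

section \<open>Piecewise-geodesic curves as counted concatenations\<close>

text \<open>
  The curve is 1-Lipschitz, so no chain of points is longer than \<open>b - a\<close>, and the chain of junctions
  attains this value.
\<close>
lemma arc_length_polygonal:
  assumes "polygonal m g a b"
  shows "arc_length g a b = ennreal (b - a)"
proof (rule antisym)
  show "arc_length g a b \<le> ennreal (b - a)"
    unfolding arc_length_def
  proof (rule SUP_least)
    fix ts assume "ts \<in> {ts. sorted ts \<and> set ts \<subseteq> {a..b}}"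
    then have ts: "sorted ts" "set ts \<subseteq> {a..b}" by auto
    have "(\<Sum>i<length ts - 1. dist (g (ts ! i)) (g (ts ! Suc i)))
        \<le> (\<Sum>i<length ts - 1. ts ! Suc i - ts ! i)"
    proof (rule sum_mono)
      fix i assume "i \<in> {..<length ts - 1}"
      then have i: "Suc i < length ts" by auto
      then have "ts ! i \<in> {a..b}" "ts ! Suc i \<in> {a..b}"
        using ts(2) nth_mem[of i ts] nth_mem[of "Suc i" ts] by (meson Suc_lessD subsetD)+
      moreover have "ts ! i \<le> ts ! Suc i" using ts(1) i by (simp add: sorted_nth_mono)
      ultimately show "dist (g (ts ! i)) (g (ts ! Suc i)) \<le> ts ! Suc i - ts ! i"
        using polygonal_lipschitz[OF assms, of "ts ! i" "ts ! Suc i"] by linarith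
    qed
    also have "\<dots> = ts ! (length ts - 1) - ts ! 0" by (rule sum_lessThan_telescope)
    also have "\<dots> \<le> b - a"
    proof (cases "ts = []")
      case True
      then show ?thesis using polygonal_le[OF assms] by simp
    next
      case False
      then have "ts ! (length ts - 1) \<in> {a..b}" "ts ! 0 \<in> {a..b}"
        using ts(2) nth_mem[of "length ts - 1" ts] nth_mem[of 0 ts]
        by (meson diff_less length_greater_0_conv subsetD zero_less_one)+
      then show ?thesis by auto
    qed
    finally show "ennreal (\<Sum>i<length ts - 1. dist (g (ts ! i)) (g (ts ! Suc i))) \<le> ennreal (b - a)"
      by (rule ennreal_leI)
  qed
next
  have "\<exists>ts. sorted (a # ts) \<and> set ts \<subseteq> {a..b} \<and>
      (\<Sum>i<length ts. dist (g ((a # ts) ! i)) (g ((a # ts) ! Suc i))) = b - a"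
    using assms
  proof (induction m arbitrary: a)
    case 0
    then show ?case by (intro exI[of _ "[]"]) auto
  next
    case (Suc m)
    then obtain c where c: "a \<le> c" "c \<le> b" "geodesic_on g a c" "polygonal m g c b" by auto
    with Suc.IH obtain ts where ts: "sorted (c # ts)" "set ts \<subseteq> {c..b}"
      "(\<Sum>i<length ts. dist (g ((c # ts) ! i)) (g ((c # ts) ! Suc i))) = b - c" by blast
    have "dist (g a) (g c) = c - a" using c by (auto simp: geodesic_on_def)
    then have "(\<Sum>i<length (c # ts). dist (g ((a # c # ts) ! i)) (g ((a # c # ts) ! Suc i))) = b - a"
      using ts(3) by (simp only: length_Cons sum.lessThan_Suc_shift) simp
    moreover have "set (c # ts) \<subseteq> {a..b}"
      using order_trans[OF ts(2), of "{a..b}"] c(1,2) by simp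
    then have "sorted (a # c # ts) \<and> set (c # ts) \<subseteq> {a..b}" using ts(1) by auto
    ultimately show ?case by blast
  qed
  then obtain ts where ts: "sorted (a # ts)" "set ts \<subseteq> {a..b}"
      "(\<Sum>i<length ts. dist (g ((a # ts) ! i)) (g ((a # ts) ! Suc i))) = b - a" by metis
  have "sorted (a # ts) \<and> set (a # ts) \<subseteq> {a..b}" using ts(1,2) polygonal_le[OF assms] by simp
  moreover have "ennreal (b - a) = ennreal (\<Sum>i<length (a # ts) - 1. dist (g ((a # ts) ! i)) (g ((a # ts) ! Suc i)))"
    using ts(3) by (simp only: length_Cons diff_Suc_1)
  ultimately show "ennreal (b - a) \<le> arc_length g a b"
    unfolding arc_length_def by (intro SUP_upper2[of "a # ts"]) (blast, metis order_refl)
qed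

text \<open>
  The isometry condition already forces the parametrization to be by arc length.
\<close>
lemma is_geodesic_iff:
  "is_geodesic c \<longleftrightarrow> 0 \<le> curve_len c \<and> geodesic_on (curve_at c) 0 (curve_len c)"
proof -
  have "arc_length (curve_at c) 0 t = ennreal t"
    if "geodesic_on (curve_at c) 0 (curve_len c)" "t \<in> {0..curve_len c}" for t
    using arc_length_polygonal[OF polygonal_geodesic, OF geodesic_on_subset, OF that(1), of 0 t] that(2)
    by auto
  then show ?thesis
    unfolding is_geodesic_def is_curve_def geodesic_on_def[symmetric] by blast
qed

lemma is_geodesic_subcurve_iff:
  assumes "a \<le> b"
  shows "is_geodesic (subcurve c a b) \<longleftrightarrow> geodesic_on (curve_at c) a b"
proof
  assume L: "is_geodesic (subcurve c a b)"
  have "dist (curve_at c s) (curve_at c t) = \<bar>s - t\<bar>" if "s \<in> {a..b}" "t \<in> {a..b}" for s t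
  proof -
    have "s - a \<in> {0..b - a}" "t - a \<in> {0..b - a}" using that by auto
    with L have "dist (curve_at c (a + (s - a))) (curve_at c (a + (t - a))) = \<bar>(s - a) - (t - a)\<bar>"
      unfolding is_geodesic_iff subcurve_def geodesic_on_def curve.sel by blast
    then show ?thesis by simp
  qed
  then show "geodesic_on (curve_at c) a b" by (simp add: geodesic_on_def)
next
  assume "geodesic_on (curve_at c) a b"
  then show "is_geodesic (subcurve c a b)"
    using assms unfolding is_geodesic_iff subcurve_def geodesic_on_def by auto
qed

lemma piecewise_geodesic_imp_polygonal:
  assumes "piecewise_geodesic c"
  obtains m where "1 \<le> m" "polygonal m (curve_at c) 0 (curve_len c)"
proof -
  obtain m \<tau> where m: "1 \<le> m" "\<tau> 0 = 0" "\<tau> m = curve_len c"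
    "\<forall>i<m. \<tau> i \<le> \<tau> (Suc i) \<and> is_geodesic (subcurve c (\<tau> i) (\<tau> (Suc i)))"
    using assms unfolding piecewise_geodesic_def by blast
  have "k \<le> m \<Longrightarrow> polygonal k (curve_at c) (\<tau> 0) (\<tau> k)" for k
  proof (induction k)
    case (Suc k)
    have "polygonal 1 (curve_at c) (\<tau> k) (\<tau> (Suc k))"
      using Suc.prems m(4) is_geodesic_subcurve_iff polygonal_geodesic by (metis Suc_le_eq)
    with Suc have "polygonal (k + 1) (curve_at c) (\<tau> 0) (\<tau> (Suc k))"
      by (intro polygonal_append[of k _ "\<tau> 0" "\<tau> k" 1]) auto
    then show ?case by simp
  qed simp
  from this[of m] show thesis using that[of m] m by simp
qed

lemma polygonal_imp_piecewise_geodesic: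
  assumes poly: "polygonal m (curve_at c) 0 (curve_len c)"
  shows "piecewise_geodesic c"
proof -
  have knots: "\<exists>\<tau>. \<tau> 0 = a \<and> \<tau> m = b \<and> (\<forall>i<m. \<tau> i \<le> \<tau> (Suc i) \<and> geodesic_on g (\<tau> i) (\<tau> (Suc i)))"
    if "polygonal m g a b" for m and g :: "real \<Rightarrow> 'a" and a b
    using that
  proof (induction m arbitrary: a)
    case 0
    then show ?case by auto
  next
    case (Suc m)
    then obtain d where d: "a \<le> d" "geodesic_on g a d" "polygonal m g d b" by auto
    with Suc.IH obtain \<tau> where \<tau>: "\<tau> 0 = d" "\<tau> m = b"
      "\<forall>i<m. \<tau> i \<le> \<tau> (Suc i) \<and> geodesic_on g (\<tau> i) (\<tau> (Suc i))" by blast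
    show ?case
      by (rule exI[of _ "case_nat a \<tau>"]) (use d \<tau> in \<open>auto split: nat.splits\<close>)
  qed
  \<comment> \<open>A degenerate piece is added so that there is at least one, as the definition demands.\<close>
  have "polygonal (Suc m) (curve_at c) 0 (curve_len c)"
    by (rule polygonal_mono[OF poly]) simp
  from knots[OF this] obtain \<tau> where \<tau>: "\<tau> 0 = 0" "\<tau> (Suc m) = curve_len c"
    "\<forall>i<Suc m. \<tau> i \<le> \<tau> (Suc i) \<and> geodesic_on (curve_at c) (\<tau> i) (\<tau> (Suc i))" by blast
  moreover have "is_curve c"
    unfolding is_curve_def
  proof (intro conjI ballI)
    show "0 \<le> curve_len c" using poly by (rule polygonal_le)
    show "arc_length (curve_at c) 0 t = ennreal t" if "t \<in> {0..curve_len c}" for t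
      using arc_length_polygonal[OF polygonal_sub[OF poly, of 0 t]] that by simp
  qed
  ultimately show ?thesis
    unfolding piecewise_geodesic_def
    by (intro conjI exI[of _ "Suc m"] exI[of _ \<tau>]) (auto simp: is_geodesic_subcurve_iff)
qed

section \<open>Concatenation and reversal of curves\<close>

abbreviation polygonal_curve :: "nat \<Rightarrow> 'a::metric_space curve \<Rightarrow> bool" where
  "polygonal_curve m c \<equiv> polygonal m (curve_at c) 0 (curve_len c)"

definition concat_curve :: "'a curve \<Rightarrow> 'a curve \<Rightarrow> 'a curve" where
  "concat_curve c d = Curve (curve_len c + curve_len d)
     (\<lambda>t. if t \<le> curve_len c then curve_at c t else curve_at d (t - curve_len c))"

definition reverse_curve :: "'a curve \<Rightarrow> 'a curve" where
  "reverse_curve c = Curve (curve_len c) (\<lambda>t. curve_at c (curve_len c - t))"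

lemma curve_len_simps [simp]:
  "curve_len (concat_curve c d) = curve_len c + curve_len d"
  "curve_len (reverse_curve c) = curve_len c"
  "curve_len (subcurve c a b) = b - a"
  by (simp_all add: concat_curve_def reverse_curve_def subcurve_def)

lemma polygonal_subcurve:
  "polygonal m (curve_at c) a b \<Longrightarrow> polygonal_curve m (subcurve c a b)"
  by (rule polygonal_shift[where s = a and g = "curve_at c"]) (auto simp: subcurve_def add.commute)

lemma polygonal_concat_curve:
  assumes c: "polygonal_curve m c" and d: "polygonal_curve k d"
    and join: "curve_at c (curve_len c) = curve_at d 0"
  shows "polygonal_curve (m + k) (concat_curve c d)"
proof -
  let ?g = "curve_at (concat_curve c d)" and ?l = "curve_len c" and ?l' = "curve_len d"
  have "polygonal m ?g 0 ?l"
    by (rule polygonal_shift[where s = 0 and g = "curve_at c"]) (use c in \<open>auto simp: concat_curve_def\<close>)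
  moreover have "polygonal k ?g ?l (?l + ?l')"
    by (rule polygonal_shift[where s = "- ?l" and g = "curve_at d"]) (use d join in \<open>auto simp: concat_curve_def\<close>)
  ultimately show ?thesis by (simp add: polygonal_append)
qed

lemma polygonal_reverse_geodesic:
  "is_geodesic c \<Longrightarrow> polygonal_curve 1 (reverse_curve c)"
  unfolding is_geodesic_iff
  by (intro polygonal_geodesic) (auto simp: geodesic_on_def reverse_curve_def)

section \<open>Currents of cut and reassembled curves\<close>

lemma current_primitive_exists:
  assumes c: "polygonal_curve m c" and f: "is_lipschitz f" and \<pi>: "is_lipschitz \<pi>"
  obtains \<Phi> where "stieltjes_primitive \<Phi> (f \<circ> curve_at c) (\<pi> \<circ> curve_at c) 0 (curve_len c)"
proof -
  have "1-lipschitz_on {0..curve_len c} (curve_at c)"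
    by (rule lipschitz_onI) (use polygonal_lipschitz[OF c] in \<open>auto simp: dist_real_def\<close>)
  then have lip: "\<exists>C. C-lipschitz_on {0..curve_len c} (h \<circ> curve_at c)" if "is_lipschitz h" for h
    using that unfolding is_lipschitz_def
    by (meson lipschitz_on_compose lipschitz_on_subset subset_UNIV)
  show thesis
    using lip[OF f] lip[OF \<pi>] polygonal_le[OF c] stieltjes_primitive_exists that by metis
qed

lemma current_of_primitive:
  assumes "0 \<le> curve_len c"
    and "stieltjes_primitive \<Phi> (f \<circ> curve_at c) (\<pi> \<circ> curve_at c) 0 (curve_len c)"
  shows "current c f \<pi> = \<Phi> (curve_len c) - \<Phi> 0"
  unfolding current_def by (rule rs_integral_of_primitive[OF assms])

text \<open>
  A primitive for the concatenation restricts to primitives for both parts.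
\<close>
lemma current_concat_curve:
  assumes c: "polygonal_curve m c" and d: "polygonal_curve k d"
    and join: "curve_at c (curve_len c) = curve_at d 0"
    and f: "is_lipschitz f" and \<pi>: "is_lipschitz \<pi>"
  shows "current (concat_curve c d) f \<pi> = current c f \<pi> + current d f \<pi>"
proof -
  let ?g = "curve_at (concat_curve c d)" and ?l = "curve_len c" and ?l' = "curve_len d"
  have len: "0 \<le> ?l" "0 \<le> ?l'" using polygonal_le c d by auto
  obtain \<Phi> where \<Phi>: "stieltjes_primitive \<Phi> (f \<circ> ?g) (\<pi> \<circ> ?g) 0 (?l + ?l')"
    using current_primitive_exists[OF polygonal_concat_curve[OF c d join] f \<pi>] by auto
  have "stieltjes_primitive \<Phi> (f \<circ> curve_at c) (\<pi> \<circ> curve_at c) 0 ?l"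
    by (rule stieltjes_primitive_cong[OF stieltjes_primitive_subinterval[OF \<Phi>]])
       (use len in \<open>auto simp: concat_curve_def\<close>)
  moreover have "stieltjes_primitive (\<lambda>t. \<Phi> (t + ?l)) (f \<circ> curve_at d) (\<pi> \<circ> curve_at d) 0 ?l'"
    by (rule stieltjes_primitive_cong[OF stieltjes_primitive_shift[OF stieltjes_primitive_subinterval[OF \<Phi>]]])
       (use len join in \<open>auto simp: concat_curve_def\<close>)
  ultimately show ?thesis
    using current_of_primitive[OF _ \<Phi>[folded curve_len_simps(1)]] len by (simp add: current_of_primitive add.commute)
qed

lemma current_subdivide:
  assumes c: "polygonal_curve m c" and ab: "0 \<le> a" "a \<le> b" "b \<le> curve_len c"
    and f: "is_lipschitz f" and \<pi>: "is_lipschitz \<pi>"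
  shows "current c f \<pi> = current (subcurve c 0 a) f \<pi> + current (subcurve c a b) f \<pi>
                         + current (subcurve c b (curve_len c)) f \<pi>"
proof -
  obtain \<Phi> where \<Phi>: "stieltjes_primitive \<Phi> (f \<circ> curve_at c) (\<pi> \<circ> curve_at c) 0 (curve_len c)"
    using current_primitive_exists[OF c f \<pi>] by blast
  have sub: "current (subcurve c p q) f \<pi> = \<Phi> q - \<Phi> p" if "0 \<le> p" "p \<le> q" "q \<le> curve_len c" for p q
  proof -
    have "stieltjes_primitive (\<lambda>t. \<Phi> (t + p)) (f \<circ> curve_at (subcurve c p q)) (\<pi> \<circ> curve_at (subcurve c p q)) 0 (q - p)"
      by (rule stieltjes_primitive_cong[OF stieltjes_primitive_shift[OF stieltjes_primitive_subinterval[OF \<Phi>]]])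
         (use that in \<open>auto simp: subcurve_def add.commute\<close>)
    then show ?thesis using current_of_primitive[of "subcurve c p q"] that by auto
  qed
  show ?thesis using current_of_primitive[OF _ \<Phi>] sub[of 0 a] sub[of a b] sub[of b "curve_len c"] ab by simp
qed

lemma current_reverse_curve:
  assumes c: "polygonal_curve m c" and f: "is_lipschitz f" and \<pi>: "is_lipschitz \<pi>"
  shows "current (reverse_curve c) f \<pi> = - current c f \<pi>"
proof -
  obtain \<Phi> where \<Phi>: "stieltjes_primitive \<Phi> (f \<circ> curve_at c) (\<pi> \<circ> curve_at c) 0 (curve_len c)"
    using current_primitive_exists[OF c f \<pi>] by blast
  from stieltjes_primitive_reflect[OF this]
  have "stieltjes_primitive (\<lambda>t. \<Phi> (curve_len c - t)) (f \<circ> curve_at (reverse_curve c))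
         (\<pi> \<circ> curve_at (reverse_curve c)) 0 (curve_len (reverse_curve c))"
    by (simp add: reverse_curve_def comp_def)
  from current_of_primitive[OF _ this] current_of_primitive[OF _ \<Phi>] polygonal_le[OF c] show ?thesis by simp
qed

section \<open>Time spent in balls and the Morrey norm\<close>

definition visits :: "(real \<Rightarrow> 'a::metric_space) \<Rightarrow> real \<Rightarrow> real \<Rightarrow> 'a \<Rightarrow> real \<Rightarrow> real set" where
  "visits g a b x r = {t\<in>{a..b}. dist x (g t) \<le> r}"

lemma morrey_norm_leI:
  assumes "0 \<le> K"
    and "\<And>x r. 0 < r \<Longrightarrow> emeasure lebesgue (visits (curve_at c) 0 (curve_len c) x r) \<le> ennreal (K * r)"
  shows "morrey_norm c \<le> ennreal K"
  unfolding morrey_norm_def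
proof (rule SUP_least)
  fix p :: "real \<times> 'a"
  assume "p \<in> {0<..} \<times> UNIV"
  then obtain r x where p: "p = (r, x)" and "r > 0" by auto
  have "emeasure lebesgue {t \<in> {0..curve_len c}. dist x (curve_at c t) \<le> r} / ennreal r \<le> ennreal (K * r) / ennreal r"
    using assms(2)[OF \<open>r > 0\<close>, of x] by (intro divide_right_mono_ennreal) (simp add: visits_def)
  also have "\<dots> = ennreal K" using assms(1) \<open>r > 0\<close> by (simp add: divide_ennreal)
  finally show "(case p of (r, x) \<Rightarrow>
      emeasure lebesgue {t \<in> {0..curve_len c}. dist x (curve_at c t) \<le> r} / ennreal r) \<le> ennreal K"
    by (simp add: p)
qed

lemma compact_visits:
  assumes "continuous_on {a..b} g"
  shows "compact (visits g a b x r)"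
proof -
  have "closed (visits g a b x r)"
    unfolding visits_def by (rule continuous_on_closed_Collect_le[OF continuous_on_dist[OF continuous_on_const assms]
          continuous_on_const closed_real_atLeastAtMost])
  moreover have "bounded (visits g a b x r)"
    by (rule bounded_subset[of "{a..b}"]) (auto simp: visits_def)
  ultimately show ?thesis by (simp add: compact_eq_bounded_closed)
qed

lemma visits_measurable: "polygonal m g a b \<Longrightarrow> visits g a b x r \<in> sets lebesgue"
  by (intro sets_completionI_sets) (auto intro: borel_compact compact_visits polygonal_continuous)

lemma emeasure_le_diameter:
  fixes S :: "real set"
  assumes "0 \<le> D" and "\<And>s t. s \<in> S \<Longrightarrow> t \<in> S \<Longrightarrow> \<bar>s - t\<bar> \<le> D"
  shows "emeasure lebesgue S \<le> ennreal D"
proof (cases "S = {}")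
  case False
  then obtain s where "s \<in> S" by blast
  have below: "s' - D \<le> t" if "s' \<in> S" "t \<in> S" for s' t using assms(2)[OF that] by linarith
  then have "bdd_below S" using \<open>s \<in> S\<close> by (meson bdd_belowI)
  have "S \<subseteq> {Inf S..Inf S + D}"
  proof
    fix t assume "t \<in> S"
    then have "t - D \<le> Inf S" using below False by (intro cInf_greatest) auto
    moreover have "Inf S \<le> t" using \<open>t \<in> S\<close> \<open>bdd_below S\<close> by (rule cInf_lower)
    ultimately show "t \<in> {Inf S..Inf S + D}" by simp
  qed
  then have "emeasure lebesgue S \<le> emeasure lebesgue {Inf S..Inf S + D}"
    by (rule emeasure_mono) simp
  then show ?thesis using assms(1) by simp
qed simp

lemma emeasure_visits_shift:
  "emeasure lebesgue (visits (\<lambda>t. g (t + s)) a b x r) = emeasure lebesgue (visits g (a + s) (b + s) x r)"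
proof -
  have "visits g (a + s) (b + s) x r = (\<lambda>t. 1 *\<^sub>R t + s) ` visits (\<lambda>t. g (t + s)) a b x r"
    unfolding visits_def
  proof (intro equalityI subsetI)
    fix t assume "t \<in> {t \<in> {a + s..b + s}. dist x (g t) \<le> r}"
    then show "t \<in> (\<lambda>t. 1 *\<^sub>R t + s) ` {t \<in> {a..b}. dist x (g (t + s)) \<le> r}"
      by (intro image_eqI[of _ _ "t - s"]) auto
  qed auto
  then show ?thesis by (simp only: emeasure_lebesgue_affine) simp
qed

lemma visits_cong:
  assumes "\<And>t. a \<le> t \<Longrightarrow> t \<le> b \<Longrightarrow> g t = h t"
  shows "visits g a b x r = visits h a b x r"
  using assms by (auto simp: visits_def)

text \<open>
  On a single geodesic two times at which the curve is in a ball of radius \<open>r\<close> differ by at most \<open>2 r\<close>.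
\<close>
lemma emeasure_visits_polygonal:
  assumes "polygonal m g a b" "0 \<le> r"
  shows "emeasure lebesgue (visits g a b x r) \<le> ennreal (real m * (2 * r))"
  using assms(1)
proof (induction m arbitrary: a)
  case 0
  then have "visits g a b x r \<subseteq> {a}" by (auto simp: visits_def)
  then have "emeasure lebesgue (visits g a b x r) \<le> emeasure lebesgue {a}"
    by (rule emeasure_mono) simp
  then show ?case by simp
next
  case (Suc m)
  then obtain c where c: "a \<le> c" "c \<le> b" "geodesic_on g a c" "polygonal m g c b" by auto
  have "\<bar>s - t\<bar> \<le> 2 * r" if "s \<in> visits g a c x r" "t \<in> visits g a c x r" for s t
  proof -
    have "\<bar>s - t\<bar> = dist (g s) (g t)" using c(3) that by (auto simp: geodesic_on_def visits_def)
    also have "\<dots> \<le> dist x (g s) + dist x (g t)" by (rule dist_triangle3)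
    finally show ?thesis using that by (auto simp: visits_def)
  qed
  then have 1: "emeasure lebesgue (visits g a c x r) \<le> ennreal (2 * r)"
    using assms(2) by (intro emeasure_le_diameter) auto
  have ac: "polygonal 1 g a c" using c by (intro polygonal_geodesic)
  have "emeasure lebesgue (visits g a b x r) \<le> emeasure lebesgue (visits g a c x r \<union> visits g c b x r)"
    by (intro emeasure_mono sets.Un visits_measurable[OF ac] visits_measurable[OF c(4)]) (auto simp: visits_def)
  also have "\<dots> \<le> emeasure lebesgue (visits g a c x r) + emeasure lebesgue (visits g c b x r)"
    by (intro emeasure_subadditive visits_measurable[OF ac] visits_measurable[OF c(4)])
  also have "\<dots> \<le> ennreal (2 * r) + ennreal (real m * (2 * r))"
    using 1 Suc.IH[OF c(4)] by (rule add_mono)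
  also have "\<dots> = ennreal (real (Suc m) * (2 * r))"
    using assms(2) by (simp add: ennreal_plus[symmetric] algebra_simps del: ennreal_plus)
  finally show ?case .
qed

lemma emeasure_visits_concat_curve:
  assumes c: "polygonal_curve m c" and d: "polygonal_curve k d"
    and join: "curve_at c (curve_len c) = curve_at d 0"
  shows "emeasure lebesgue (visits (curve_at (concat_curve c d)) 0 (curve_len c + curve_len d) x r)
      \<le> emeasure lebesgue (visits (curve_at c) 0 (curve_len c) x r)
       + emeasure lebesgue (visits (curve_at d) 0 (curve_len d) x r)"
proof -
  let ?g = "curve_at (concat_curve c d)" and ?l = "curve_len c" and ?l' = "curve_len d"
  have len: "0 \<le> ?l" "0 \<le> ?l'" using polygonal_le c d by auto
  have cd: "polygonal (m + k) ?g 0 (?l + ?l')" using polygonal_concat_curve[OF assms] by simp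
  have meas: "visits ?g 0 ?l x r \<in> sets lebesgue" "visits ?g ?l (?l + ?l') x r \<in> sets lebesgue"
    using polygonal_sub[OF cd, of 0 ?l] polygonal_sub[OF cd, of ?l "?l + ?l'"] len
    by (auto intro: visits_measurable)
  have "emeasure lebesgue (visits ?g 0 (?l + ?l') x r)
      \<le> emeasure lebesgue (visits ?g 0 ?l x r \<union> visits ?g ?l (?l + ?l') x r)"
    by (intro emeasure_mono sets.Un meas) (auto simp: visits_def)
  also have "\<dots> \<le> emeasure lebesgue (visits ?g 0 ?l x r) + emeasure lebesgue (visits ?g ?l (?l + ?l') x r)"
    by (intro emeasure_subadditive meas)
  also have "visits ?g 0 ?l x r = visits (curve_at c) 0 ?l x r"
    by (rule visits_cong) (simp add: concat_curve_def)
  also have "emeasure lebesgue (visits ?g ?l (?l + ?l') x r) = emeasure lebesgue (visits (\<lambda>t. ?g (t + ?l)) 0 ?l' x r)"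
    using emeasure_visits_shift[of ?g ?l 0 ?l' x r] by (simp add: add.commute)
  also have "visits (\<lambda>t. ?g (t + ?l)) 0 ?l' x r = visits (curve_at d) 0 ?l' x r"
    by (rule visits_cong) (use join in \<open>auto simp: concat_curve_def\<close>)
  finally show ?thesis .
qed

text \<open>
  All visits to a ball lie between the first and the last one. If these two are at most \<open>\<delta>\<close> apart,
  only \<open>k\<close> pieces matter; if not, the quasi-geodesic bound applies to the two points, which are at distance
  at most \<open>2 r\<close> from each other.
\<close>
lemma emeasure_visits_quasi_geodesic:
  assumes poly: "polygonal m g a b" and "0 < \<epsilon>" "0 \<le> r"
    and short: "\<And>p q. a \<le> p \<Longrightarrow> p \<le> q \<Longrightarrow> q \<le> b \<Longrightarrow> q - p \<le> \<delta> \<Longrightarrow> polygonal k g p q"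
    and long: "\<And>p q. a \<le> p \<Longrightarrow> p \<le> q \<Longrightarrow> q \<le> b \<Longrightarrow> \<delta> < q - p \<Longrightarrow> \<epsilon> * (q - p) \<le> dist (g p) (g q)"
  shows "emeasure lebesgue (visits g a b x r) \<le> ennreal (max (2 / \<epsilon>) (2 * real k) * r)"
proof (cases "visits g a b x r = {}")
  case False
  define S where "S = visits g a b x r"
  have mem: "t \<in> S \<longleftrightarrow> a \<le> t \<and> t \<le> b \<and> dist x (g t) \<le> r" for t
    by (auto simp: S_def visits_def)
  have "compact S" unfolding S_def by (rule compact_visits[OF polygonal_continuous[OF poly]])
  obtain p where p: "p \<in> S" "\<And>s. s \<in> S \<Longrightarrow> p \<le> s"
    using compact_attains_inf[OF \<open>compact S\<close>] False S_def by blast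
  obtain q where q: "q \<in> S" "\<And>s. s \<in> S \<Longrightarrow> s \<le> q"
    using compact_attains_sup[OF \<open>compact S\<close>] False S_def by blast
  have pq: "a \<le> p" "p \<le> q" "q \<le> b" "dist x (g p) \<le> r" "dist x (g q) \<le> r"
    using p(1) q(1) p(2)[OF q(1)] unfolding mem by auto
  show ?thesis
  proof (cases "q - p \<le> \<delta>")
    case True
    have "t \<in> S \<longleftrightarrow> t \<in> visits g p q x r" for t
      using p(2)[of t] q(2)[of t] pq(1,3) by (auto simp: mem visits_def)
    then have "visits g a b x r = visits g p q x r" unfolding S_def by blast
    then have "emeasure lebesgue (visits g a b x r) \<le> ennreal (real k * (2 * r))"
      using emeasure_visits_polygonal[OF short[OF pq(1-3) True] \<open>0 \<le> r\<close>] by simp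
    also have "\<dots> \<le> ennreal (max (2 / \<epsilon>) (2 * real k) * r)"
      using mult_right_mono[of "2 * real k" "max (2 / \<epsilon>) (2 * real k)" r] \<open>0 \<le> r\<close>
      by (intro ennreal_leI) (simp add: algebra_simps)
    finally show ?thesis .
  next
    case False
    then have "\<epsilon> * (q - p) \<le> dist (g p) (g q)" using long pq by simp
    also have "\<dots> \<le> dist x (g p) + dist x (g q)" by (rule dist_triangle3)
    finally have "q - p \<le> (2 / \<epsilon>) * r" using pq \<open>0 < \<epsilon>\<close> by (simp add: field_simps)
    then have "\<bar>s - t\<bar> \<le> (2 / \<epsilon>) * r" if "s \<in> S" "t \<in> S" for s t
      using p(2) q(2) that by (smt (verit))
    then have "emeasure lebesgue S \<le> ennreal ((2 / \<epsilon>) * r)"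
      using \<open>0 < \<epsilon>\<close> \<open>0 \<le> r\<close> by (intro emeasure_le_diameter) auto
    also have "\<dots> \<le> ennreal (max (2 / \<epsilon>) (2 * real k) * r)"
      using \<open>0 \<le> r\<close> by (intro ennreal_leI mult_right_mono) auto
    finally show ?thesis by (simp add: S_def)
  qed
qed simp

section \<open>Cutting off loops\<close>

text \<open>
  The chord is traversed in opposite directions by the loop and by the rest, so its contributions to
  the currents cancel. The counts \<open>i\<close> and \<open>j\<close> refer to the parts before \<open>s\<close> and after \<open>t\<close>.
\<close>
lemma cut_along_chord:
  fixes c :: "'a::metric_space curve"
  assumes geo: "geodesic_space TYPE('a)" and closed: "closed_curve c"
    and i: "polygonal i (curve_at c) 0 s" and k: "polygonal k (curve_at c) s t"
    and j: "polygonal j (curve_at c) t (curve_len c)"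
  obtains loop rest where
    "closed_curve loop" "closed_curve rest"
    "polygonal_curve (k + 1) loop" "polygonal_curve (i + 1 + j) rest"
    "curve_len loop = (t - s) + dist (curve_at c s) (curve_at c t)"
    "curve_len rest = curve_len c - (t - s) + dist (curve_at c s) (curve_at c t)"
    "\<And>f \<pi>. is_lipschitz f \<Longrightarrow> is_lipschitz \<pi> \<Longrightarrow> current c f \<pi> = current loop f \<pi> + current rest f \<pi>"
    "\<And>x r. 0 \<le> r \<Longrightarrow> emeasure lebesgue (visits (curve_at loop) 0 (curve_len loop) x r)
        \<le> emeasure lebesgue (visits (curve_at c) s t x r) + ennreal (2 * r)"
proof -
  have st: "0 \<le> s" "s \<le> t" "t \<le> curve_len c" using i j k polygonal_le by blast+
  obtain \<kappa> where \<kappa>: "is_geodesic \<kappa>" "curve_at \<kappa> 0 = curve_at c s" "curve_at \<kappa> (curve_len \<kappa>) = curve_at c t"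
    using geo unfolding geodesic_space_def by blast
  have len0: "0 \<le> curve_len \<kappa>" using \<kappa>(1) by (simp add: is_geodesic_iff)
  then have len: "curve_len \<kappa> = dist (curve_at c s) (curve_at c t)"
  proof -
    have "dist (curve_at \<kappa> 0) (curve_at \<kappa> (curve_len \<kappa>)) = \<bar>0 - curve_len \<kappa>\<bar>"
      using \<kappa>(1) len0 unfolding is_geodesic_iff geodesic_on_def by (meson atLeastAtMost_iff order_refl)
    then show ?thesis using \<kappa>(2,3) len0 by simp
  qed
  have p\<kappa>: "polygonal_curve 1 \<kappa>" using \<kappa>(1) polygonal_geodesic is_geodesic_iff by blast
  have pr: "polygonal_curve 1 (reverse_curve \<kappa>)" by (rule polygonal_reverse_geodesic[OF \<kappa>(1)])
  let ?a = "subcurve c 0 s" and ?b = "subcurve c s t" and ?d = "subcurve c t (curve_len c)"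
  note poly = polygonal_subcurve[OF i] polygonal_subcurve[OF k] polygonal_subcurve[OF j]
  let ?loop = "concat_curve ?b (reverse_curve \<kappa>)" and ?init = "concat_curve ?a \<kappa>"
  let ?rest = "concat_curve ?init ?d"
  have join_loop: "curve_at ?b (curve_len ?b) = curve_at (reverse_curve \<kappa>) 0"
    and join_init: "curve_at ?a (curve_len ?a) = curve_at \<kappa> 0"
    using \<kappa> by (auto simp: subcurve_def reverse_curve_def)
  have join_rest: "curve_at ?init (curve_len ?init) = curve_at ?d 0"
    using \<kappa> len0 join_init by (auto simp: concat_curve_def subcurve_def)
  have p_init: "polygonal_curve (i + 1) ?init" by (rule polygonal_concat_curve[OF poly(1) p\<kappa> join_init])
  show thesis
  proof
    show "closed_curve ?loop"
      using \<kappa> st len0 by (auto simp: closed_curve_def concat_curve_def subcurve_def reverse_curve_def)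
    have "curve_at ?rest (curve_len ?rest) = curve_at c (curve_len c)"
      using \<kappa> st len0 by (auto simp: concat_curve_def subcurve_def)
    moreover have "curve_at ?rest 0 = curve_at c 0"
      using st len0 by (auto simp: concat_curve_def subcurve_def)
    ultimately show "closed_curve ?rest" using closed by (simp add: closed_curve_def)
    show "polygonal_curve (k + 1) ?loop" by (rule polygonal_concat_curve[OF poly(2) pr join_loop])
    show "polygonal_curve (i + 1 + j) ?rest" by (rule polygonal_concat_curve[OF p_init poly(3) join_rest])
    show "curve_len ?loop = (t - s) + dist (curve_at c s) (curve_at c t)"
      "curve_len ?rest = curve_len c - (t - s) + dist (curve_at c s) (curve_at c t)"
      by (simp_all add: len)
    show "current c f \<pi> = current ?loop f \<pi> + current ?rest f \<pi>"
      if f: "is_lipschitz f" and \<pi>: "is_lipschitz \<pi>" for f \<pi>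
      using current_subdivide[OF polygonal_append[OF polygonal_append[OF i k] j] st f \<pi>]
        current_concat_curve[OF poly(2) pr join_loop f \<pi>]
        current_concat_curve[OF poly(1) p\<kappa> join_init f \<pi>]
        current_concat_curve[OF p_init poly(3) join_rest f \<pi>]
        current_reverse_curve[OF p\<kappa> f \<pi>]
      by simp
    show "emeasure lebesgue (visits (curve_at ?loop) 0 (curve_len ?loop) x r)
        \<le> emeasure lebesgue (visits (curve_at c) s t x r) + ennreal (2 * r)" if "0 \<le> r" for x r
    proof -
      have "emeasure lebesgue (visits (curve_at ?loop) 0 (curve_len ?loop) x r)
        \<le> emeasure lebesgue (visits (curve_at ?b) 0 (curve_len ?b) x r)
          + emeasure lebesgue (visits (curve_at (reverse_curve \<kappa>)) 0 (curve_len (reverse_curve \<kappa>)) x r)"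
        using emeasure_visits_concat_curve[OF poly(2) pr join_loop] by simp
      also have "emeasure lebesgue (visits (curve_at ?b) 0 (curve_len ?b) x r)
          = emeasure lebesgue (visits (curve_at c) s t x r)"
        using emeasure_visits_shift[of "curve_at c" s 0 "t - s" x r] by (simp add: subcurve_def add.commute)
      also have "emeasure lebesgue (visits (curve_at (reverse_curve \<kappa>)) 0 (curve_len (reverse_curve \<kappa>)) x r)
          \<le> ennreal (2 * r)"
        using emeasure_visits_polygonal[OF pr that] by simp
      finally show ?thesis by (simp add: add_left_mono)
    qed
  qed
qed

text \<open>
  The pairs \<open>(s, t)\<close> that satisfy the first four conclusions form a compact set, which is nonempty because
  the closed curve itself is a shortcut. A pair with minimal \<open>t - s\<close> has no proper subarc among
  the shortcuts; the reversed inequality extends to the full arc by continuity.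
\<close>
lemma shortest_shortcut:
  assumes c: "polygonal m g 0 l" and closed: "g l = g 0"
    and \<epsilon>: "0 < \<epsilon>" and \<delta>: "0 < \<delta>" "\<delta> \<le> l"
  obtains s t where "0 \<le> s" "t \<le> l" "\<delta> \<le> t - s" "dist (g s) (g t) \<le> \<epsilon> * (t - s)"
    "\<And>p q. s \<le> p \<Longrightarrow> p \<le> q \<Longrightarrow> q \<le> t \<Longrightarrow> \<delta> < q - p \<Longrightarrow> \<epsilon> * (q - p) \<le> dist (g p) (g q)"
proof -
  define P where "P = ({0..l} \<times> {0..l}) \<inter> {z \<in> {0..l} \<times> {0..l}. \<delta> \<le> snd z - fst z}
    \<inter> {z \<in> {0..l} \<times> {0..l}. dist (g (fst z)) (g (snd z)) \<le> \<epsilon> * (snd z - fst z)}"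
  have cont: "continuous_on {0..l} g" by (rule polygonal_continuous[OF c])
  have cont_fst: "continuous_on ({0..l} \<times> {0..l}) (\<lambda>z. g (fst z))"
    and cont_snd: "continuous_on ({0..l} \<times> {0..l}) (\<lambda>z. g (snd z))"
    by (auto intro!: continuous_on_compose2[OF cont] continuous_intros)
  have closed_box: "closed ({0..l} \<times> {0..l})" by (intro closed_Times closed_real_atLeastAtMost)
  have "compact P"
    unfolding P_def
    by (intro compact_Int_closed compact_Times compact_Icc continuous_on_closed_Collect_le
        continuous_intros cont_fst cont_snd closed_box)
  moreover have "(0, l) \<in> P" using \<epsilon> \<delta> closed by (simp add: P_def)
  moreover have "continuous_on P (\<lambda>z. snd z - fst z)" by (intro continuous_intros)
  ultimately obtain z where "z \<in> P" and z_min: "\<And>w. w \<in> P \<Longrightarrow> snd z - fst z \<le> snd w - fst w"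
    using continuous_attains_inf[of P "\<lambda>z. snd z - fst z"] by blast
  then obtain s t where z: "z = (s, t)" by (cases z)
  have st: "0 \<le> s" "s \<le> l" "0 \<le> t" "t \<le> l" "\<delta> \<le> t - s" "dist (g s) (g t) \<le> \<epsilon> * (t - s)"
    using \<open>z \<in> P\<close> by (auto simp: P_def z)
  have strict: "\<epsilon> * (q - p) < dist (g p) (g q)"
    if "s \<le> p" "q \<le> t" "\<delta> \<le> q - p" "q - p < t - s" for p q
    using z_min[of "(p, q)"] that st \<delta> by (force simp: P_def z)
  show thesis
  proof
    show "0 \<le> s" "t \<le> l" "\<delta> \<le> t - s" "dist (g s) (g t) \<le> \<epsilon> * (t - s)" by (fact st)+
    fix p q assume pq: "s \<le> p" "p \<le> q" "q \<le> t" "\<delta> < q - p"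
    show "\<epsilon> * (q - p) \<le> dist (g p) (g q)"
    proof (rule field_le_epsilon)
      fix e :: real assume "e > 0"
      \<comment> \<open>A slightly shorter subarc is strictly shorter than the minimal one; \<open>\<eta>\<close> is so small that
         shortening the subarc by \<open>\<eta>\<close> changes both sides by no more than \<open>e\<close> in total.\<close>
      define \<eta> where "\<eta> = min (e / (1 + \<epsilon>)) (q - p - \<delta>)"
      have "\<eta> > 0" "\<eta> \<le> q - p - \<delta>" using \<open>e > 0\<close> \<epsilon> pq by (auto simp: \<eta>_def)
      have "\<eta> \<le> e / (1 + \<epsilon>)" by (simp add: \<eta>_def)
      then have "(1 + \<epsilon>) * \<eta> \<le> e" using \<epsilon> by (simp add: pos_le_divide_eq mult.commute)
      from \<open>\<eta> > 0\<close> \<open>\<eta> \<le> q - p - \<delta>\<close> have "\<epsilon> * (q - \<eta> - p) < dist (g p) (g (q - \<eta>))"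
        using pq \<delta> by (intro strict) auto
      also have "\<dots> \<le> dist (g p) (g q) + dist (g q) (g (q - \<eta>))" by (rule dist_triangle)
      also have "dist (g q) (g (q - \<eta>)) \<le> \<eta>"
        using polygonal_lipschitz[OF c, of q "q - \<eta>"] \<open>\<eta> > 0\<close> \<open>\<eta> \<le> q - p - \<delta>\<close> pq st \<delta> by auto
      finally show "\<epsilon> * (q - p) \<le> dist (g p) (g q) + e"
        using \<open>(1 + \<epsilon>) * \<eta> \<le> e\<close> by (simp add: algebra_simps)
    qed
  qed
qed

text \<open>
  The induction is on the integer part of \<open>W = m + 3 L / ((1 - \<epsilon>) \<delta>)\<close>, where \<open>L\<close> is the length. A cluster of
  \<open>k\<close> short pieces lowers \<open>W\<close> by \<open>k - 1\<close> and costs \<open>2 \<delta>\<close>, which explains the coefficient of \<open>W\<close> in the bound. A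
  shortcut of length \<open>a \<ge> \<delta>\<close> adds at most 2 to \<open>m\<close> and lowers the second term by at least 3.
\<close>
lemma loop_decomposition:
  fixes c :: "'a::metric_space curve"
  assumes geo: "geodesic_space TYPE('a)" and \<epsilon>: "0 < \<epsilon>" "\<epsilon> < 1" and \<delta>: "0 < \<delta>" and k: "2 \<le> k"
    and "closed_curve c" "polygonal_curve m c"
  shows "\<exists>ds. ds \<noteq> [] \<and>
     (\<forall>d\<in>set ds. closed_curve d \<and> piecewise_geodesic d \<and>
        morrey_norm d \<le> ennreal (max (2 / \<epsilon>) (2 * real (k + 1)) + 2)) \<and>
     (\<forall>f \<pi>. is_lipschitz f \<and> is_lipschitz \<pi> \<longrightarrow> current c f \<pi> = (\<Sum>d\<leftarrow>ds. current d f \<pi>)) \<and>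
     (\<Sum>d\<leftarrow>ds. curve_len d) \<le> (1 + \<epsilon>) / (1 - \<epsilon>) * curve_len c
        + 2 * \<delta> / real (k - 1) * (real m + 3 * curve_len c / ((1 - \<epsilon>) * \<delta>))"
  using assms(6,7)
proof (induction "nat \<lfloor>real m + 3 * curve_len c / ((1 - \<epsilon>) * \<delta>)\<rfloor>" arbitrary: m c rule: less_induct)
  case less
  define A where "A = (1 + \<epsilon>) / (1 - \<epsilon>)"
  define B where "B = 2 * \<delta> / real (k - 1)"
  define W where "W m l = real m + 3 * l / ((1 - \<epsilon>) * \<delta>)" for m l
  define K where "K = max (2 / \<epsilon>) (2 * real (k + 1)) + 2"
  define good where "good d \<longleftrightarrow> closed_curve d \<and> piecewise_geodesic d \<and> morrey_norm d \<le> ennreal K"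
    for d :: "'a curve"
  let ?L = "curve_len c" and ?g = "curve_at c"
  note c = \<open>polygonal_curve m c\<close>
  have L: "0 \<le> ?L" by (rule polygonal_le[OF c])
  have A1: "1 \<le> A" using \<epsilon> by (simp add: A_def)
  have B0: "0 < B" using \<delta> k by (simp add: B_def)
  have K0: "0 \<le> K" using \<epsilon> by (simp add: K_def)
  \<comment> \<open>Curves with few pieces are acceptable on all scales at once.\<close>
  have few: "good d" if "polygonal_curve j d" "closed_curve d" "j \<le> k + 1" for j d
  proof -
    have "morrey_norm d \<le> ennreal K"
    proof (rule morrey_norm_leI[OF K0])
      fix x r assume "0 < (r::real)"
      have "real j * 2 \<le> K" using \<open>j \<le> k + 1\<close> by (simp add: K_def)
      then have "real j * 2 * r \<le> K * r" using \<open>0 < r\<close> by (intro mult_right_mono) auto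
      then show "emeasure lebesgue (visits (curve_at d) 0 (curve_len d) x r) \<le> ennreal (K * r)"
        using emeasure_visits_polygonal[OF that(1), of r x] \<open>0 < r\<close>
        by (auto intro: order_trans ennreal_leI simp: mult.assoc)
    qed
    then show ?thesis using that polygonal_imp_piecewise_geodesic by (simp add: good_def)
  qed
  \<comment> \<open>One cut, of either kind, followed by the induction hypothesis for the rest.\<close>
  have step: ?case
    if loop: "good loop" and rest: "closed_curve rest" "polygonal_curve m' rest"
      and cur: "\<And>f \<pi>. is_lipschitz f \<Longrightarrow> is_lipschitz \<pi> \<Longrightarrow> current c f \<pi> = current loop f \<pi> + current rest f \<pi>"
      and W_drop: "W m' (curve_len rest) \<le> W m ?L - 1"
      and cost: "curve_len loop + A * curve_len rest + B * W m' (curve_len rest) \<le> A * ?L + B * W m ?L"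
    for loop rest m'
  proof -
    have "0 \<le> W m' (curve_len rest)"
      using polygonal_le[OF rest(2)] \<epsilon> \<delta> by (simp add: W_def)
    then have "nat \<lfloor>W m' (curve_len rest)\<rfloor> < nat \<lfloor>W m ?L\<rfloor>" using W_drop by linarith
    then obtain ds where ds: "ds \<noteq> []" "\<forall>d\<in>set ds. good d"
      "\<forall>f \<pi>. is_lipschitz f \<and> is_lipschitz \<pi> \<longrightarrow> current rest f \<pi> = (\<Sum>d\<leftarrow>ds. current d f \<pi>)"
      "(\<Sum>d\<leftarrow>ds. curve_len d) \<le> A * curve_len rest + B * W m' (curve_len rest)"
      using less.hyps[of m' rest] rest unfolding good_def A_def B_def W_def K_def by blast
    have "(\<Sum>d\<leftarrow>loop # ds. curve_len d) \<le> A * ?L + B * W m ?L" using ds(4) cost by simp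
    moreover have "\<forall>d\<in>set (loop # ds). good d" using ds(2) loop by simp
    moreover have "\<forall>f \<pi>. is_lipschitz f \<and> is_lipschitz \<pi> \<longrightarrow>
        current c f \<pi> = (\<Sum>d\<leftarrow>loop # ds. current d f \<pi>)"
      using ds(3) cur by simp
    ultimately show ?thesis
      unfolding good_def A_def B_def W_def K_def by (intro exI[of _ "loop # ds"]) simp
  qed
  show ?case
  proof (cases "\<exists>i u v. i + k \<le> m \<and> polygonal i ?g 0 u \<and> polygonal k ?g u v \<and>
      polygonal (m - i - k) ?g v ?L \<and> v - u \<le> \<delta>")
    case True
    then obtain i u v where iuv: "i + k \<le> m" "polygonal i ?g 0 u" "polygonal k ?g u v"
      "polygonal (m - i - k) ?g v ?L" "v - u \<le> \<delta>" by blast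
    obtain loop rest where cut: "closed_curve loop" "closed_curve rest"
      "polygonal_curve (k + 1) loop" "polygonal_curve (i + 1 + (m - i - k)) rest"
      "curve_len loop = (v - u) + dist (?g u) (?g v)"
      "curve_len rest = ?L - (v - u) + dist (?g u) (?g v)"
      "\<And>f \<pi>. is_lipschitz f \<Longrightarrow> is_lipschitz \<pi> \<Longrightarrow> current c f \<pi> = current loop f \<pi> + current rest f \<pi>"
      using cut_along_chord[OF geo \<open>closed_curve c\<close> iuv(2,3,4)] by metis
    have "u \<le> v" using iuv(3) by (rule polygonal_le)
    then have "dist (?g u) (?g v) \<le> v - u" using polygonal_lipschitz[OF iuv(3), of u v] by simp
    then have len: "curve_len rest \<le> ?L" "curve_len loop \<le> 2 * \<delta>" using cut(5,6) iuv(5) by auto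
    have pieces: "real (i + 1 + (m - i - k)) = real m - real (k - 1)" using iuv(1) k by (simp add: of_nat_diff)
    have "3 * curve_len rest / ((1 - \<epsilon>) * \<delta>) \<le> 3 * ?L / ((1 - \<epsilon>) * \<delta>)"
      using len(1) \<epsilon> \<delta> by (intro divide_right_mono) auto
    then have W: "W (i + 1 + (m - i - k)) (curve_len rest) \<le> W m ?L - real (k - 1)"
      unfolding W_def pieces by linarith
    show ?thesis
    proof (rule step[OF few[OF cut(3,1)] cut(2,4,7)])
      show "W (i + 1 + (m - i - k)) (curve_len rest) \<le> W m ?L - 1" using W k by linarith
      have "B * W (i + 1 + (m - i - k)) (curve_len rest) \<le> B * (W m ?L - real (k - 1))"
        using W B0 by (intro mult_left_mono) auto
      also have "\<dots> = B * W m ?L - 2 * \<delta>" using k by (simp add: B_def field_simps)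
      finally show "curve_len loop + A * curve_len rest + B * W (i + 1 + (m - i - k)) (curve_len rest)
          \<le> A * ?L + B * W m ?L"
        using len mult_left_mono[OF len(1), of A] A1 by linarith
    qed simp
  next
    case no_cluster: False
    then have window: "polygonal (k + 1) ?g p q" if "0 \<le> p" "p \<le> q" "q \<le> ?L" "q - p \<le> \<delta>" for p q
      using polygonal_window[OF c, of k \<delta>] that by (metis Suc_eq_plus1)
    show ?thesis
    proof (cases "?L < \<delta>")
      case True
      have "good c" using few[of "k + 1" c] window[of 0 ?L] True L \<open>closed_curve c\<close> by simp
      moreover have "?L \<le> A * ?L + B * W m ?L"
      proof -
        have "0 \<le> W m ?L" using L \<epsilon> \<delta> by (simp add: W_def)
        then have "0 \<le> B * W m ?L" using B0 by simp
        then show ?thesis using mult_right_mono[OF A1 L] by simp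
      qed
      ultimately show ?thesis
        unfolding good_def A_def B_def W_def K_def by (intro exI[of _ "[c]"]) simp
    next
      case False
      have "?g ?L = ?g 0" using \<open>closed_curve c\<close> by (simp add: closed_curve_def)
      moreover have "\<delta> \<le> ?L" using False by simp
      ultimately obtain s t where st: "0 \<le> s" "t \<le> ?L" "\<delta> \<le> t - s" "dist (?g s) (?g t) \<le> \<epsilon> * (t - s)"
        and long: "\<And>p q. s \<le> p \<Longrightarrow> p \<le> q \<Longrightarrow> q \<le> t \<Longrightarrow> \<delta> < q - p \<Longrightarrow> \<epsilon> * (q - p) \<le> dist (?g p) (?g q)"
        using shortest_shortcut[OF c _ \<epsilon>(1) \<delta>] by blast
      have "s \<le> t" using st \<delta> by linarith
      obtain i j where ij: "i + j \<le> Suc m" "polygonal i ?g 0 s" "polygonal j ?g s ?L"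
        using polygonal_cut[OF c st(1)] st \<open>s \<le> t\<close> by auto
      have arc: "polygonal j ?g s t" and tail: "polygonal j ?g t ?L"
        using polygonal_sub[OF ij(3)] st \<open>s \<le> t\<close> by auto
      obtain loop rest where cut: "closed_curve loop" "closed_curve rest"
        "polygonal_curve (j + 1) loop" "polygonal_curve (i + 1 + j) rest"
        "curve_len loop = (t - s) + dist (?g s) (?g t)"
        "curve_len rest = ?L - (t - s) + dist (?g s) (?g t)"
        "\<And>f \<pi>. is_lipschitz f \<Longrightarrow> is_lipschitz \<pi> \<Longrightarrow> current c f \<pi> = current loop f \<pi> + current rest f \<pi>"
        "\<And>x r. 0 \<le> r \<Longrightarrow> emeasure lebesgue (visits (curve_at loop) 0 (curve_len loop) x r)
            \<le> emeasure lebesgue (visits ?g s t x r) + ennreal (2 * r)"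
        using cut_along_chord[OF geo \<open>closed_curve c\<close> ij(2) arc tail] by metis
      have "morrey_norm loop \<le> ennreal K"
      proof (rule morrey_norm_leI[OF K0])
        fix x r assume "0 < (r::real)"
        have "emeasure lebesgue (visits ?g s t x r) \<le> ennreal (max (2 / \<epsilon>) (2 * real (k + 1)) * r)"
          using \<open>0 < r\<close> \<epsilon> long st window
          by (intro emeasure_visits_quasi_geodesic[OF arc, where \<delta> = \<delta>]) auto
        then have "emeasure lebesgue (visits (curve_at loop) 0 (curve_len loop) x r)
            \<le> ennreal (max (2 / \<epsilon>) (2 * real (k + 1)) * r) + ennreal (2 * r)"
          using cut(8)[of r x] \<open>0 < r\<close> by (auto intro: order_trans add_right_mono)
        also have "\<dots> = ennreal (K * r)"
          using \<open>0 < r\<close> \<epsilon> by (subst ennreal_plus[symmetric]) (auto simp: K_def algebra_simps le_max_iff_disj)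
        finally show "emeasure lebesgue (visits (curve_at loop) 0 (curve_len loop) x r) \<le> ennreal (K * r)" .
      qed
      then have "good loop"
        using cut(1) polygonal_imp_piecewise_geodesic[OF cut(3)] by (simp add: good_def)
      have loop_len: "curve_len loop \<le> (1 + \<epsilon>) * (t - s)" and rest_len: "curve_len rest \<le> ?L - (1 - \<epsilon>) * (t - s)"
        using cut(5,6) st(4) by (simp_all add: algebra_simps)
      have "3 * curve_len rest / ((1 - \<epsilon>) * \<delta>) \<le> 3 * (?L - (1 - \<epsilon>) * (t - s)) / ((1 - \<epsilon>) * \<delta>)"
        using rest_len \<epsilon> \<delta> by (intro divide_right_mono mult_left_mono) auto
      also have "\<dots> = 3 * ?L / ((1 - \<epsilon>) * \<delta>) - 3 * ((t - s) / \<delta>)"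
      proof -
        have "3 * ((1 - \<epsilon>) * (t - s)) / ((1 - \<epsilon>) * \<delta>) = 3 * ((t - s) / \<delta>)" using \<epsilon> by simp
        then show ?thesis by (simp only: right_diff_distrib diff_divide_distrib)
      qed
      also have "\<dots> \<le> 3 * ?L / ((1 - \<epsilon>) * \<delta>) - 3"
      proof -
        have "1 \<le> (t - s) / \<delta>" using st(3) \<delta> by (simp add: pos_le_divide_eq)
        then show ?thesis by linarith
      qed
      finally have W: "W (i + 1 + j) (curve_len rest) \<le> W m ?L - 1"
        using ij(1) unfolding W_def by linarith
      have "A * curve_len rest \<le> A * (?L - (1 - \<epsilon>) * (t - s))"
        using rest_len A1 by (intro mult_left_mono) auto
      also have "\<dots> = A * ?L - (1 + \<epsilon>) * (t - s)"
      proof -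
        have "A * (1 - \<epsilon>) = 1 + \<epsilon>" using \<epsilon> by (simp add: A_def)
        then show ?thesis by (simp only: right_diff_distrib mult.assoc[symmetric])
      qed
      finally have "curve_len loop + A * curve_len rest \<le> A * ?L" using loop_len by linarith
      moreover have "B * W (i + 1 + j) (curve_len rest) \<le> B * W m ?L" using W B0 by simp
      ultimately show ?thesis
        by (intro step[OF \<open>good loop\<close> cut(2,4,7) W]) auto
    qed
  qed
qed

section \<open>Choice of the scale\<close>

theorem lemma3p1:
  fixes \<epsilon> :: real and n :: nat and \<gamma> :: "'a::polish_space curve"
  assumes "geodesic_space TYPE('a)"
    and "0 < \<epsilon>" "\<epsilon> < 1" and "1 \<le> n"
    and "closed_curve \<gamma>" "piecewise_geodesic \<gamma>"
  shows "\<exists>(N::nat) (\<Gamma> :: nat \<Rightarrow> 'a curve). 1 \<le> N \<and>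
     (\<forall>j\<in>{1..N}. closed_curve (\<Gamma> j) \<and> piecewise_geodesic (\<Gamma> j)) \<and>
     (\<forall>f \<pi>. is_lipschitz f \<and> bounded (range f) \<and> is_lipschitz \<pi> \<longrightarrow>
        current \<gamma> f \<pi> = (\<Sum>j=1..N. current (\<Gamma> j) f \<pi>)) \<and>
     (\<Sum>j=1..N. curve_len (\<Gamma> j))
        \<le> (1 + 2 * \<epsilon> / (1 - \<epsilon>) + 12 * inverse \<epsilon> / (real n * (1 - \<epsilon>))) * curve_len \<gamma> \<and>
     (\<forall>j\<in>{1..N}. morrey_norm (\<Gamma> j) \<le> ennreal (4 * inverse \<epsilon> + 2 * real n + 10))"
proof -
  obtain m where m: "1 \<le> m" "polygonal_curve m \<gamma>"
    using piecewise_geodesic_imp_polygonal[OF assms(6)] .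
  define L where "L = curve_len \<gamma>"
  define K where "K = 4 * inverse \<epsilon> + 2 * real n + 10"
  define C where "C = 1 + 2 * \<epsilon> / (1 - \<epsilon>) + 12 * inverse \<epsilon> / (real n * (1 - \<epsilon>))"
  have "0 \<le> L" unfolding L_def by (rule polygonal_le[OF m(2)])
  have K0: "0 \<le> K" using assms(2) by (simp add: K_def)
  obtain ds where ds: "ds \<noteq> []"
    "\<forall>d\<in>set ds. closed_curve d \<and> piecewise_geodesic d \<and> morrey_norm d \<le> ennreal K"
    "\<forall>f \<pi>. is_lipschitz f \<and> is_lipschitz \<pi> \<longrightarrow> current \<gamma> f \<pi> = (\<Sum>d\<leftarrow>ds. current d f \<pi>)"
    "(\<Sum>d\<leftarrow>ds. curve_len d) \<le> C * L"
  \<comment> \<open>A curve of length 0 is kept as it is: there is no positive scale \<open>\<delta>\<close> with \<open>\<delta> m \<le> L\<close> for it.\<close>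
  proof (cases "L = 0")
    case True
    have "emeasure lebesgue (visits (curve_at \<gamma>) 0 (curve_len \<gamma>) x r) \<le> ennreal (K * r)" for x r
    proof -
      have "visits (curve_at \<gamma>) 0 (curve_len \<gamma>) x r \<subseteq> {0}" using True by (auto simp: L_def visits_def)
      then have "emeasure lebesgue (visits (curve_at \<gamma>) 0 (curve_len \<gamma>) x r) \<le> emeasure lebesgue {0::real}"
        by (rule emeasure_mono) simp
      then show ?thesis by simp
    qed
    then have "morrey_norm \<gamma> \<le> ennreal K" by (intro morrey_norm_leI K0)
    then show thesis using assms(5,6) True by (intro that[of "[\<gamma>]"]) (auto simp: L_def)
  next
    case False
    \<comment> \<open>Then \<open>\<delta> m = L\<close>, and both terms of the potential are of order \<open>m\<close>.\<close>
    define \<delta> where "\<delta> = L / real m"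
    have "\<delta> > 0" using False \<open>0 \<le> L\<close> m(1) by (simp add: \<delta>_def)
    obtain ds where ds: "ds \<noteq> []"
      "\<forall>d\<in>set ds. closed_curve d \<and> piecewise_geodesic d \<and>
          morrey_norm d \<le> ennreal (max (2 / \<epsilon>) (2 * real (n + 4 + 1)) + 2)"
      "\<forall>f \<pi>. is_lipschitz f \<and> is_lipschitz \<pi> \<longrightarrow> current \<gamma> f \<pi> = (\<Sum>d\<leftarrow>ds. current d f \<pi>)"
      "(\<Sum>d\<leftarrow>ds. curve_len d) \<le> (1 + \<epsilon>) / (1 - \<epsilon>) * L
          + 2 * \<delta> / real (n + 4 - 1) * (real m + 3 * L / ((1 - \<epsilon>) * \<delta>))"
      \<comment> \<open>For \<open>k = n + 4\<close> the piece bound is \<open>2 (k + 1) = 2 n + 10\<close>; the \<open>2 r\<close> for the chord, and the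
         alternative \<open>2 / \<epsilon> + 2\<close>, are absorbed by \<open>4 / \<epsilon>\<close> because \<open>1 / \<epsilon> > 1\<close>.\<close>
      using loop_decomposition[OF assms(1-3) \<open>\<delta> > 0\<close> _ assms(5) m(2), of "n + 4"] by (auto simp: L_def)
    have "1 < inverse \<epsilon>" using assms(2,3) by (simp add: one_less_inverse)
    then have "max (2 / \<epsilon>) (2 * real (n + 4 + 1)) + 2 \<le> K"
      by (simp add: K_def divide_inverse)
    then have morrey: "morrey_norm d \<le> ennreal K" if "d \<in> set ds" for d
      using ds(2) that by (meson ennreal_leI order_trans)
    have "2 * \<delta> / real (n + 4 - 1) * (real m + 3 * L / ((1 - \<epsilon>) * \<delta>))
        = (2 * (1 + 3 / (1 - \<epsilon>))) * L / real (n + 3)"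
    proof -
      have "3 * L / ((1 - \<epsilon>) * \<delta>) = 3 * real m / (1 - \<epsilon>)" using False by (simp add: \<delta>_def)
      then have "real m + 3 * L / ((1 - \<epsilon>) * \<delta>) = real m * (1 + 3 / (1 - \<epsilon>))"
        by (simp add: distrib_left mult.commute)
      then have "2 * \<delta> / real (n + 4 - 1) * (real m + 3 * L / ((1 - \<epsilon>) * \<delta>))
          = 2 * (\<delta> * real m) * (1 + 3 / (1 - \<epsilon>)) / real (n + 4 - 1)"
        by simp
      moreover have "\<delta> * real m = L" "n + 4 - 1 = n + 3" using m(1) by (auto simp: \<delta>_def)
      ultimately show ?thesis by (simp only: mult_ac)
    qed
    also have "\<dots> \<le> 12 * inverse \<epsilon> / (1 - \<epsilon>) * L / real n"
    proof (intro frac_le mult_right_mono)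
      have "2 * (1 + 3 / (1 - \<epsilon>)) = (8 - 2 * \<epsilon>) / (1 - \<epsilon>)" using assms(3) by (simp add: field_simps)
      also have "\<dots> \<le> 12 * inverse \<epsilon> / (1 - \<epsilon>)"
      proof (rule divide_right_mono)
        show "8 - 2 * \<epsilon> \<le> 12 * inverse \<epsilon>" using assms(2) \<open>1 < inverse \<epsilon>\<close> by linarith
      qed (use assms(3) in simp)
      finally show "2 * (1 + 3 / (1 - \<epsilon>)) \<le> 12 * inverse \<epsilon> / (1 - \<epsilon>)" .
    qed (use assms \<open>0 \<le> L\<close> in auto)
    also have "(1 + \<epsilon>) / (1 - \<epsilon>) * L + \<dots> = C * L"
    proof -
      have "(1 + \<epsilon>) / (1 - \<epsilon>) = 1 + 2 * \<epsilon> / (1 - \<epsilon>)" using assms(3) by (simp add: field_simps)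
      moreover have "12 * inverse \<epsilon> / (1 - \<epsilon>) * L / real n = 12 * inverse \<epsilon> / (real n * (1 - \<epsilon>)) * L" by simp
      ultimately show ?thesis unfolding C_def by (simp only: distrib_right)
    qed
    finally have "(\<Sum>d\<leftarrow>ds. curve_len d) \<le> C * L" using ds(4) by linarith
    then show thesis using ds morrey by (intro that[of ds]) auto
  qed
  define \<Gamma> where "\<Gamma> j = ds ! (j - 1)" for j
  have sum: "(\<Sum>j=1..length ds. h (\<Gamma> j)) = (\<Sum>d\<leftarrow>ds. h d)" for h :: "'a curve \<Rightarrow> real"
    by (simp add: \<Gamma>_def sum_list_sum_nth sum.atLeast1_atMost_eq atLeast0LessThan)
  have mem: "\<Gamma> j \<in> set ds" if "j \<in> {1..length ds}" for j using that by (auto simp: \<Gamma>_def)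
  show ?thesis
  proof (intro exI[of _ "length ds"] exI[of _ \<Gamma>] conjI ballI allI impI)
    show "1 \<le> length ds" using ds(1) by (cases ds) auto
    show "(\<Sum>j=1..length ds. curve_len (\<Gamma> j))
        \<le> (1 + 2 * \<epsilon> / (1 - \<epsilon>) + 12 * inverse \<epsilon> / (real n * (1 - \<epsilon>))) * curve_len \<gamma>"
      using ds(4) unfolding sum C_def L_def .
    show "current \<gamma> f \<pi> = (\<Sum>j=1..length ds. current (\<Gamma> j) f \<pi>)"
      if "is_lipschitz f \<and> bounded (range f) \<and> is_lipschitz \<pi>" for f \<pi>
      using ds(3)[rule_format, of f \<pi>] that sum[of "\<lambda>d. current d f \<pi>"] by argo
    show "closed_curve (\<Gamma> j)" "piecewise_geodesic (\<Gamma> j)"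
      "morrey_norm (\<Gamma> j) \<le> ennreal (4 * inverse \<epsilon> + 2 * real n + 10)"
      if "j \<in> {1..length ds}" for j
      using ds(2) mem[OF that] unfolding K_def by blast+
  qed
qed

end
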